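(* Let $L>0$ and let $\{W_i\}_{i\ge1}$ be a sequence of independent uniformly distributed random variables on $(0,2L)\times\mathbb S^{d-1}$. Then $$E\bigl(\|S_{W_1\dots W_n}f-f^*\|_1\bigr)\le 2d\,m(B_{2L})\,\|f\|_\infty\,n^{-1}$$ for every $n\ge1$ and every nonnegative bounded measurable function $f$ on $\mathbb R^d$ with support in $B_L$. If, additionally, $f$ is Hölder continuous with modulus of continuity $\eta(\delta)\le c\,\delta^\alpha$ for some $\alpha\in(0,1]$ and $c>0$, then $$E\bigl(\|S_{W_1\dots W_n}f-f^*\|_\infty\bigr)\le 10\,c\,L^\alpha\,n^{-\frac{\alpha}{d+\alpha}} .$$
   Context: $m$ is Lebesgue measure on $\mathbb R^d$, and $B_\rho$ is the ball of radius $\rho$ centered at the origin. $\eta(\delta)=\sup_{|x-y|\le\delta}|f(x)-f(y)|$ is the modulus of continuity of $f$. For $A\subset\mathbb R^d$ of finite volume, $A^*$ is the open ball centered at the origin with $m(A^* )=m(A)$; $f^*$ is the lower semicontinuous radially decreasing function with $\{f^*>t\}=\{f>t\}^*$ for all $t>0$ (symmetric decreasing rearrangement). For $\omega=(r,u)$ with $r>0$, $u\in\mathbb S^{d-1}$, $\sigma_\omega$ is the Euclidean reflection at a hyperplane that maps the origin to $ru$. Writing $\bar x=\sigma_\omega x$, $H^+=\{x:|x|\le|\bar x|\}$, $H^-=\{x:|x|\ge|\bar x|\}$, the polarization is $S_\omega f(x)=\max\{f(x),f(\bar x)\}$ for $x\in H^+$ and $S_\omega f(x)=\min\{f(x),f(\bar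 x)\}$ for $x\in H^-$. Set $S_{\omega_1\dots\omega_n}=S_{\omega_n}\circ\dots\circ S_{\omega_1}$. "Uniformly distributed" means with respect to the normalized product of Lebesgue measure $dr$ and the standard surface measure on $\mathbb S^{d-1}$. *)

theory Defs
  imports "HOL-Probability.Probability"
begin

text \<open>
  The ambient space \<open>\<real>\<^sup>d\<close> is an arbitrary Euclidean space \<open>'a\<close> with \<open>d = DIM('a)\<close>, and \<open>m\<close> is
  \<^const>\<open>lebesgue\<close>.  Measures, norms and expectations of nonnegative quantities take values in
  \<^typ>\<open>ennreal\<close>, so that none of them is replaced by a default value when it is infinite.
\<close>

subsection \<open>Norms and modulus of continuity\<close>

definition L1_norm :: "('a::euclidean_space \<Rightarrow> real) \<Rightarrow> ennreal" where
  "L1_norm g = (\<integral>\<^sup>+ x. ennreal \<bar>g x\<bar> \<partial>lebesgue)"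

text \<open>The essential supremum with respect to \<open>m\<close>; for continuous \<open>g\<close> this is the supremum.\<close>

definition Linf_norm :: "('a::euclidean_space \<Rightarrow> real) \<Rightarrow> ennreal" where
  "Linf_norm g = esssup lebesgue (\<lambda>x. ennreal \<bar>g x\<bar>)"

definition modulus_of_continuity :: "('a::euclidean_space \<Rightarrow> real) \<Rightarrow> real \<Rightarrow> ennreal" where
  "modulus_of_continuity f \<delta> = (SUP (x, y) \<in> {(x, y). dist x y \<le> \<delta>}. ennreal \<bar>f x - f y\<bar>)"

subsection \<open>Symmetric decreasing rearrangement\<close>

text \<open>For \<open>A\<close> of finite volume.  If \<open>A\<close> is a null set, the ball is empty (radius \<open>0\<close>).\<close>

definition symm_set :: "'a::euclidean_space set \<Rightarrow> 'a set" where
  "symm_set A = (THE B. (\<exists>\<rho>. B = ball 0 \<rho>) \<and> emeasure lebesgue B = emeasure lebesgue A)"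

definition lower_semicontinuous :: "('a::topological_space \<Rightarrow> real) \<Rightarrow> bool" where
  "lower_semicontinuous g \<longleftrightarrow> (\<forall>t. open {x. t < g x})"

definition radially_decreasing :: "('a::real_normed_vector \<Rightarrow> real) \<Rightarrow> bool" where
  "radially_decreasing g \<longleftrightarrow> (\<forall>x y. norm x \<le> norm y \<longrightarrow> g y \<le> g x)"

text \<open>
  The level sets with \<open>t > 0\<close> determine only the positive part of a function; nonnegativity of the
  rearrangement, tacit in the usual definition, is therefore stated explicitly.
\<close>

definition is_symm_decr_rearrangement ::
    "('a::euclidean_space \<Rightarrow> real) \<Rightarrow> ('a \<Rightarrow> real) \<Rightarrow> bool" where
  "is_symm_decr_rearrangement f g \<longleftrightarrow>
     (\<forall>x. 0 \<le> g x) \<and> lower_semicontinuous g \<and> radially_decreasing g \<and>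
     (\<forall>t>0. {x. t < g x} = symm_set {x. t < f x})"

definition symm_decr_rearrangement :: "('a::euclidean_space \<Rightarrow> real) \<Rightarrow> 'a \<Rightarrow> real" where
  "symm_decr_rearrangement f = (THE g. is_symm_decr_rearrangement f g)"

subsection \<open>Polarization\<close>

definition hyperplane_reflection :: "'a::euclidean_space \<Rightarrow> real \<Rightarrow> 'a \<Rightarrow> 'a" where
  "hyperplane_reflection a b x = x - (2 * (a \<bullet> x - b) / (a \<bullet> a)) *\<^sub>R a"

text \<open>
  For \<open>\<omega> = (r, u)\<close> the hyperplane \<open>{x. u \<bullet> x = r / 2}\<close> is the perpendicular bisector of
  \<open>0\<close> and \<open>r u\<close>.
\<close>

definition sigma_refl :: "real \<times> 'a::euclidean_space \<Rightarrow> 'a \<Rightarrow> 'a" where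
  "sigma_refl \<omega> = hyperplane_reflection (snd \<omega>) (fst \<omega> / 2)"

text \<open>Points of \<open>H\<^sup>+ \<inter> H\<^sup>-\<close> are fixed by the reflection, so there both branches agree.\<close>

definition polarization :: "real \<times> 'a::euclidean_space \<Rightarrow> ('a \<Rightarrow> real) \<Rightarrow> 'a \<Rightarrow> real" where
  "polarization \<omega> f x =
     (if norm x \<le> norm (sigma_refl \<omega> x) then max (f x) (f (sigma_refl \<omega> x)) else min (f x) (f (sigma_refl \<omega> x)))"

text \<open>\<open>polarizations [\<omega>\<^sub>1, \<dots>, \<omega>\<^sub>n]\<close> is \<open>S\<^bsub>\<omega>\<^sub>n\<^esub> \<circ> \<dots> \<circ> S\<^bsub>\<omega>\<^sub>1\<^esub>\<close>: the head of the list acts first.\<close>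

definition polarizations :: "(real \<times> 'a::euclidean_space) list \<Rightarrow> ('a \<Rightarrow> real) \<Rightarrow> 'a \<Rightarrow> real" where
  "polarizations = fold polarization"

subsection \<open>The uniform distribution on \<open>(0, 2L) \<times> \<S>\<^bsup>d-1\<^esup>\<close>\<close>

text \<open>
  Standard surface measure on the unit sphere, as the cone measure
  \<open>A \<mapsto> d m {t u | 0 < t < 1, u \<in> A}\<close>.  For \<open>d = 1\<close> it is counting measure on \<open>{-1, 1}\<close>.
\<close>

definition surface_measure :: "'a::euclidean_space measure" where
  "surface_measure = scale_measure (of_nat DIM('a))
     (distr (restrict_space lborel (ball 0 1 - {0})) (restrict_space borel (sphere 0 1))
        (\<lambda>x. x /\<^sub>R norm x))"

definition reflection_measure :: "real \<Rightarrow> (real \<times> 'a::euclidean_space) measure" where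
  "reflection_measure L = restrict_space lborel {0<..<2 * L} \<Otimes>\<^sub>M surface_measure"

definition uniform_reflection :: "real \<Rightarrow> (real \<times> 'a::euclidean_space) measure" where
  "uniform_reflection L = uniform_measure (reflection_measure L) (space (reflection_measure L))"

subsection \<open>Well-definedness\<close>

lemma sigma_refl_origin:
  assumes "norm u = 1"
  shows "sigma_refl (r, u) 0 = r *\<^sub>R u"
proof -
  have "u \<bullet> u = 1" using assms by (simp add: dot_square_norm)
  thus ?thesis by (simp add: sigma_refl_def hyperplane_reflection_def)
qed

lemma sigma_refl_eq_norm_iff:
  assumes "norm u = 1" "0 < r"
  shows "norm x = norm (sigma_refl (r, u) x) \<longleftrightarrow> sigma_refl (r, u) x = x"
proof -
  have u: "u \<bullet> u = 1" using assms by (simp add: dot_square_norm)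
  define s where "s = 2 * (u \<bullet> x - r / 2)"
  have R: "sigma_refl (r, u) x = x - s *\<^sub>R u"
    by (simp add: sigma_refl_def hyperplane_reflection_def s_def u)
  have "(norm (x - s *\<^sub>R u))\<^sup>2 = (norm x)\<^sup>2 - s * r"
    unfolding power2_norm_eq_inner s_def
    by (simp add: inner_diff_left inner_diff_right inner_commute u) (simp add: algebra_simps power2_eq_square)
  hence "norm x = norm (x - s *\<^sub>R u) \<Longrightarrow> s = 0" using assms by simp
  thus ?thesis unfolding R by auto
qed

lemma symm_set_eqI:
  fixes A :: "'a::euclidean_space set"
  assumes "emeasure lebesgue (ball (0::'a) \<rho>) = emeasure lebesgue A"
  shows "symm_set A = ball 0 \<rho>"
  unfolding symm_set_def
proof (rule the_equality)
  show "(\<exists>\<rho>'. ball (0::'a) \<rho> = ball 0 \<rho>') \<and> emeasure lebesgue (ball (0::'a) \<rho>) = emeasure lebesgue A"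
    using assms by blast
  fix B :: "'a set"
  assume "(\<exists>\<rho>'. B = ball 0 \<rho>') \<and> emeasure lebesgue B = emeasure lebesgue A"
  then obtain s where s: "B = ball 0 s" "emeasure lebesgue (ball (0::'a) s) = emeasure lebesgue A"
    by blast
  have *: "emeasure lebesgue (ball (0::'a) t) =
      ennreal (unit_ball_vol (real DIM('a)) * max 0 t ^ DIM('a))" for t
  proof (cases "0 \<le> t")
    case True
    then show ?thesis by (simp add: emeasure_ball)
  next
    case False
    then have e: "ball (0::'a) t = {}" "max 0 t = 0" by auto
    show ?thesis unfolding e by (simp add: zero_power)
  qed
  have "unit_ball_vol (real DIM('a)) * max 0 s ^ DIM('a) = unit_ball_vol (real DIM('a)) * max 0 \<rho> ^ DIM('a)"
    using s(2) assms unfolding * by (metis ennreal_inj max.cobounded1 mult_nonneg_nonneg of_nat_0_le_iff unit_ball_vol_nonneg zero_le_power)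
  hence "max 0 s ^ DIM('a) = max 0 \<rho> ^ DIM('a)"
    by (metis less_irrefl mult_cancel_left of_nat_0_le_iff unit_ball_vol_pos)
  hence "max 0 s = max 0 \<rho>"
    using power_eq_imp_eq_base[of "max 0 s" "DIM('a)" "max 0 \<rho>"] by simp
  moreover have "ball (0::'a) t = ball 0 (max 0 t)" for t
    by (cases "0 \<le> t") (auto simp: max_def)
  ultimately show "B = ball 0 \<rho>" using s(1) by metis
qed

lemma symm_set_ball:
  fixes A :: "'a::euclidean_space set"
  assumes "emeasure lebesgue A < \<infinity>"
  shows "\<exists>\<rho>\<ge>0. symm_set A = ball 0 \<rho> \<and> emeasure lebesgue (ball (0::'a) \<rho>) = emeasure lebesgue A"
proof -
  let ?c = "unit_ball_vol (real DIM('a))"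
  obtain v where v: "0 \<le> v" "emeasure lebesgue A = ennreal v"
    using assms by (metis ennreal_cases less_irrefl infinity_ennreal_def)
  define \<rho> where "\<rho> = root DIM('a) (v / ?c)"
  have c: "0 < ?c" by simp
  then have c0: "?c \<noteq> 0" by (metis less_irrefl)
  have "0 \<le> \<rho>" using v c by (simp add: \<rho>_def)
  moreover have "emeasure lebesgue (ball (0::'a) \<rho>) = emeasure lebesgue A"
  proof -
    have "\<rho> ^ DIM('a) = v / ?c" unfolding \<rho>_def
      using v c by (intro real_root_pow_pos2) auto
    thus ?thesis using v \<open>0 \<le> \<rho>\<close> by (simp add: emeasure_ball c0)
  qed
  ultimately show ?thesis using symm_set_eqI by blast
qed

lemma symm_set_mono:
  fixes A B :: "'a::euclidean_space set"
  assumes "emeasure lebesgue A \<le> emeasure lebesgue B" "emeasure lebesgue B < \<infinity>"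
  shows "symm_set A \<subseteq> symm_set B"
proof -
  obtain a where a: "symm_set A = ball 0 a" "emeasure lebesgue (ball (0::'a) a) = emeasure lebesgue A"
    using symm_set_ball[of A] assms by (auto simp: le_less_trans)
  obtain b where b: "symm_set B = ball 0 b" "emeasure lebesgue (ball (0::'a) b) = emeasure lebesgue B"
    using symm_set_ball[of B] assms by auto
  show ?thesis
  proof (cases "a \<le> b")
    case True
    then show ?thesis unfolding a b by (rule subset_ball)
  next
    case False
    then have "ball (0::'a) b \<subseteq> ball 0 a" by (intro subset_ball) simp
    then have "emeasure lebesgue (ball (0::'a) b) \<le> emeasure lebesgue (ball (0::'a) a)"
      by (intro emeasure_mono) auto
    then have "emeasure lebesgue (ball (0::'a) b) = emeasure lebesgue A" using a b assms by auto
    then show ?thesis using symm_set_eqI b(1) by blast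
  qed
qed

lemma is_symm_decr_rearrangement_unique:
  assumes "is_symm_decr_rearrangement f g" "is_symm_decr_rearrangement f h"
  shows "g = h"
proof
  fix x
  have 1: "0 \<le> g x" "0 \<le> h x" using assms by (auto simp: is_symm_decr_rearrangement_def)
  have 2: "t < g x \<longleftrightarrow> t < h x" if "0 < t" for t
    using assms that unfolding is_symm_decr_rearrangement_def by blast
  show "g x = h x"
  proof (rule ccontr)
    assume "g x \<noteq> h x"
    then consider "g x < h x" | "h x < g x" by linarith
    then show False
    proof cases
      case 1
      with 2[of "(g x + h x) / 2"] \<open>0 \<le> g x\<close> show False by simp
    next
      case 2
      with \<open>\<And>t. 0 < t \<Longrightarrow> t < g x \<longleftrightarrow> t < h x\<close>[of "(g x + h x) / 2"] \<open>0 \<le> h x\<close> show False by simp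
    qed
  qed
qed

lemma symm_decr_rearrangement:
  fixes f :: "'a::euclidean_space \<Rightarrow> real"
  assumes meas: "f \<in> borel_measurable lebesgue" and bdd: "\<And>x. f x \<le> C"
    and fin: "\<And>t. 0 < t \<Longrightarrow> emeasure lebesgue {x. t < f x} < \<infinity>"
  shows "is_symm_decr_rearrangement f (symm_decr_rearrangement f)"
proof -
  let ?A = "\<lambda>t. {x. t < f x}"
  define T where "T x = insert 0 {t. 0 < t \<and> x \<in> symm_set (?A t)}" for x
  define g where "g x = Sup (T x)" for x
  have A [measurable]: "?A t \<in> sets lebesgue" for t
    using borel_measurable_less[of "\<lambda>_. t" lebesgue f] meas by simp
  have bdT: "t \<le> max 0 C" if "t \<in> T x" for t x
  proof (rule ccontr)
    assume "\<not> t \<le> max 0 C"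
    hence "t > 0" "C < t" by auto
    moreover from this(2) have "?A t = {}" using bdd by (auto simp: not_less intro: order.trans[OF _ less_imp_le])
    moreover have "symm_set ({}::'a set) = ball 0 0" by (rule symm_set_eqI) simp
    ultimately show False using that by (simp add: T_def)
  qed
  have bT: "bdd_above (T x)" for x by (rule bdd_aboveI[of _ "max 0 C"]) (rule bdT)
  have neT: "T x \<noteq> {}" for x by (simp add: T_def)
  have g_less: "s < g x \<longleftrightarrow> (\<exists>t\<in>T x. s < t)" for s x
    unfolding g_def by (rule less_cSup_iff[OF neT bT])
  have g0: "0 \<le> g x" for x unfolding g_def by (rule cSup_upper[OF _ bT]) (simp add: T_def)
  have level: "{x. t < g x} = symm_set (?A t)" if t: "0 < t" for t
  proof (intro equalityI subsetI)
    fix x assume "x \<in> {x. t < g x}"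
    then obtain s where s: "s \<in> T x" "t < s" using g_less by auto
    with t have "x \<in> symm_set (?A s)" by (auto simp: T_def)
    moreover have "symm_set (?A s) \<subseteq> symm_set (?A t)"
      using s t fin by (intro symm_set_mono emeasure_mono) auto
    ultimately show "x \<in> symm_set (?A t)" by blast
  next
    fix x assume x: "x \<in> symm_set (?A t)"
    obtain \<rho> where \<rho>: "symm_set (?A t) = ball 0 \<rho>" "emeasure lebesgue (ball (0::'a) \<rho>) = emeasure lebesgue (?A t)"
      using symm_set_ball[OF fin[OF t]] by auto
    have "norm x < \<rho>" using x \<rho> by simp
    have U: "(\<Union>n. ?A (t + inverse (real (Suc n)))) = ?A t"
    proof (intro equalityI subsetI)
      fix y assume "y \<in> ?A t"
      then obtain n where "inverse (real (Suc n)) < f y - t"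
        using reals_Archimedean[of "f y - t"] by auto
      then show "y \<in> (\<Union>n. ?A (t + inverse (real (Suc n))))" by (auto simp: algebra_simps intro!: exI[of _ n])
    next
      fix y assume "y \<in> (\<Union>n. ?A (t + inverse (real (Suc n))))"
      then obtain n where "t + inverse (real (Suc n)) < f y" by auto
      moreover have "0 < inverse (real (Suc n))" by simp
      ultimately have "t < f y" by linarith
      then show "y \<in> ?A t" by simp
    qed
    have inc: "incseq (\<lambda>n. ?A (t + inverse (real (Suc n))))"
    proof (intro monoI subsetI)
      fix m n :: nat and y assume "m \<le> n" "y \<in> ?A (t + inverse (real (Suc m)))"
      moreover from \<open>m \<le> n\<close> have "inverse (real (Suc n)) \<le> inverse (real (Suc m))" by simp
      moreover from \<open>y \<in> _\<close> have "t + inverse (real (Suc m)) < f y" by blast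
      ultimately have "t + inverse (real (Suc n)) < f y" by linarith
      then show "y \<in> ?A (t + inverse (real (Suc n)))" by blast
    qed
    have lim: "(\<lambda>n. emeasure lebesgue (?A (t + inverse (real (Suc n))))) \<longlonglongrightarrow> emeasure lebesgue (?A t)"
      using Lim_emeasure_incseq[of "\<lambda>n. ?A (t + inverse (real (Suc n)))" lebesgue] inc A
      unfolding U by blast
    have "emeasure lebesgue (ball (0::'a) (norm x)) < emeasure lebesgue (ball (0::'a) \<rho>)"
    proof -
      have "norm x ^ DIM('a) < \<rho> ^ DIM('a)" using \<open>norm x < \<rho>\<close> by (intro power_strict_mono) auto
      moreover have "0 \<le> \<rho>" using \<open>norm x < \<rho>\<close> norm_ge_zero[of x] by linarith
      ultimately show ?thesis
        by (simp add: emeasure_ball ennreal_less_iff)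
    qed
    then have "emeasure lebesgue (ball (0::'a) (norm x)) < emeasure lebesgue (?A t)" using \<rho> by simp
    with lim have "\<forall>\<^sub>F n in sequentially.
        emeasure lebesgue (ball (0::'a) (norm x)) < emeasure lebesgue (?A (t + inverse (real (Suc n))))"
      by (rule order_tendstoD)
    then obtain n where n: "emeasure lebesgue (ball (0::'a) (norm x)) <
        emeasure lebesgue (?A (t + inverse (real (Suc n))))"
      by (auto simp: eventually_sequentially)
    define s where "s = t + inverse (real (Suc n))"
    have s: "t < s" by (simp add: s_def del: of_nat_Suc)
    obtain \<sigma> where \<sigma>: "symm_set (?A s) = ball 0 \<sigma>" "emeasure lebesgue (ball (0::'a) \<sigma>) = emeasure lebesgue (?A s)"
      using symm_set_ball[OF fin[of s]] s t by auto
    have "norm x < \<sigma>"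
    proof (rule ccontr)
      assume "\<not> norm x < \<sigma>"
      then have "emeasure lebesgue (ball (0::'a) \<sigma>) \<le> emeasure lebesgue (ball (0::'a) (norm x))"
        by (intro emeasure_mono subset_ball) auto
      with n \<sigma> show False by (simp add: s_def)
    qed
    then have "s \<in> T x" using s t \<sigma> by (simp add: T_def)
    then show "x \<in> {x. t < g x}" using g_less s by auto
  qed
  have ball_lev: "\<exists>\<rho>. {x. t < g x} = ball 0 \<rho>" if "0 < t" for t
    using level[OF that] symm_set_ball[OF fin[OF that]] by metis
  have "lower_semicontinuous g"
    unfolding lower_semicontinuous_def
  proof
    fix t :: real
    consider "t < 0" | "t = 0" | "0 < t" by linarith
    then show "open {x. t < g x}"
    proof cases
      case 1
      then have "{x. t < g x} = UNIV" using g0 by (auto intro: less_le_trans)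
      then show ?thesis by simp
    next
      case 2
      have "{x. 0 < g x} = (\<Union>s\<in>{0<..}. {x. s < g x})" by (auto dest: dense)
      also have "open \<dots>" using ball_lev by (intro open_UN ballI) (metis greaterThan_iff open_ball)
      finally show ?thesis using 2 by simp
    next
      case 3
      then show ?thesis using ball_lev by (metis open_ball)
    qed
  qed
  moreover have "radially_decreasing g"
    unfolding radially_decreasing_def
  proof (intro allI impI)
    fix x y :: 'a assume le: "norm x \<le> norm y"
    show "g y \<le> g x"
    proof (rule ccontr)
      assume "\<not> g y \<le> g x"
      then obtain t where t: "g x < t" "t < g y" using dense by (metis not_le)
      with g0[of x] have "0 < t" by linarith
      then obtain \<rho> where "{x. t < g x} = ball 0 \<rho>" using ball_lev by blast
      with t le show False by (metis dist_0_norm le_less_trans mem_Collect_eq mem_ball not_less_iff_gr_or_eq)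
    qed
  qed
  ultimately have g: "is_symm_decr_rearrangement f g"
    unfolding is_symm_decr_rearrangement_def using g0 level by blast
  moreover have "symm_decr_rearrangement f = g"
    unfolding symm_decr_rearrangement_def
    by (rule the_equality[of "is_symm_decr_rearrangement f", OF g]) (rule is_symm_decr_rearrangement_unique[OF _ g])
  ultimately show ?thesis by simp
qed

lemma space_surface_measure [simp]: "space (surface_measure :: 'a::euclidean_space measure) = sphere 0 1"
  by (simp add: surface_measure_def space_scale_measure space_restrict_space)

lemma sets_surface_measure:
  "sets (surface_measure :: 'a::euclidean_space measure) = sets (restrict_space borel (sphere 0 1))"
  by (simp add: surface_measure_def)

lemma emeasure_surface_measure:
  fixes A :: "'a::euclidean_space set"
  assumes "A \<in> sets borel" "A \<subseteq> sphere 0 1"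
  shows "emeasure surface_measure A =
    of_nat DIM('a) * emeasure lebesgue {x \<in> ball 0 1. x \<noteq> 0 \<and> x /\<^sub>R norm x \<in> A}"
proof -
  have m: "(\<lambda>x::'a. x /\<^sub>R norm x) \<in> restrict_space lborel (ball 0 1 - {0}) \<rightarrow>\<^sub>M restrict_space borel (sphere 0 1)"
    by (intro measurable_restrict_space2 measurable_restrict_space1) (auto simp: space_restrict_space)
  have A: "A \<in> sets (restrict_space borel (sphere 0 1))"
    using assms by (auto simp: sets_restrict_space_iff)
  let ?C = "{x \<in> ball 0 1. x \<noteq> 0 \<and> x /\<^sub>R norm x \<in> A}"
  have eq: "(\<lambda>x::'a. x /\<^sub>R norm x) -` A \<inter> (ball 0 1 - {0}) = ?C" by auto
  have "(\<lambda>x::'a. x /\<^sub>R norm x) -` A \<in> sets borel"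
    using assms(1) measurable_sets[of "\<lambda>x::'a. x /\<^sub>R norm x" borel borel A] by simp
  then have "(\<lambda>x::'a. x /\<^sub>R norm x) -` A \<inter> (ball 0 1 - {0}) \<in> sets borel" by auto
  then have C: "?C \<in> sets borel" unfolding eq .
  have "emeasure (restrict_space lborel (ball (0::'a) 1 - {0})) ?C = emeasure lborel ?C"
    by (rule emeasure_restrict_space) auto
  then show ?thesis
    unfolding surface_measure_def
    using m A C by (subst emeasure_scale_measure, subst emeasure_distr)
      (simp_all add: space_restrict_space eq)
qed

lemma emeasure_surface_measure_space:
  "emeasure (surface_measure :: 'a::euclidean_space measure) (sphere 0 1) =
     ennreal (real DIM('a) * unit_ball_vol (real DIM('a)))"
proof -
  have "emeasure (surface_measure :: 'a measure) (sphere 0 1) =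
      of_nat DIM('a) * emeasure lebesgue {x \<in> ball (0::'a) 1. x \<noteq> 0 \<and> x /\<^sub>R norm x \<in> sphere 0 1}"
    by (rule emeasure_surface_measure) auto
  also have "{x \<in> ball (0::'a) 1. x \<noteq> 0 \<and> x /\<^sub>R norm x \<in> sphere 0 1} = ball 0 1 - {0}" by auto
  also have "emeasure lebesgue (ball (0::'a) 1 - {0}) = emeasure lebesgue (ball (0::'a) 1)"
    by (intro emeasure_Diff_null_set) auto
  finally show ?thesis by (simp add: emeasure_ball ennreal_mult ennreal_of_nat_eq_real_of_nat)
qed

lemma prob_space_uniform_reflection:
  assumes "0 < L"
  shows "prob_space (uniform_reflection L :: (real \<times> 'a::euclidean_space) measure)"
proof -
  interpret S: finite_measure "surface_measure :: 'a measure"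
    by (rule finite_measureI) (simp add: emeasure_surface_measure_space)
  have "emeasure (reflection_measure L :: (real \<times> 'a) measure) (space (reflection_measure L)) =
      ennreal (2 * L) * ennreal (real DIM('a) * unit_ball_vol (real DIM('a)))"
    unfolding reflection_measure_def space_pair_measure
    using assms by (subst S.emeasure_pair_measure_Times)
      (auto simp: sets_restrict_space_iff space_restrict_space emeasure_restrict_space sets_surface_measure
        emeasure_surface_measure_space[symmetric])
  also have "\<dots> = ennreal (2 * L * (real DIM('a) * unit_ball_vol (real DIM('a))))"
    using assms by (intro ennreal_mult[symmetric]) auto
  finally have e: "emeasure (reflection_measure L :: (real \<times> 'a) measure) (space (reflection_measure L)) =
      ennreal (2 * L * (real DIM('a) * unit_ball_vol (real DIM('a))))" .
  have "0 < 2 * L * (real DIM('a) * unit_ball_vol (real DIM('a)))"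
    using assms by (intro mult_pos_pos) auto
  then show ?thesis
    unfolding uniform_reflection_def
    by (intro prob_space_uniform_measure) (simp_all only: e ennreal_eq_0_iff not_le ennreal_neq_top not_False_eq_True infinity_ennreal_def)
qed

end

(* For a superlevel set A of f, with rearrangement the ball B, the symmetric difference of A and B
   never grows under a polarization, and it loses twice the volume of {x in B - A. sigma x in A - B}.
   For |x| < |y| the random reflection sends x to y with density at least 1 / (d m(B_2L)), so one
   random step takes a discrepancy z to at most z - z^2 / K on average, with K = 2 d m(B_2L), and
   hence E z_n <= K / n.  Integrating over the levels gives the bound in L^1.

   Polarization preserves every modulus of continuity, and so does the rearrangement, being an
   L^1 limit of polarizations.  A difference that exceeds 2 eta(delta) + s somewhere is larger than s on a
   ball of radius delta, so its supremum is at most 2 eta(delta) + ||.||_1 / m(B_delta); the rate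
   follows with delta = 4 L n^(-1 / (d + alpha)). *)

theory Submission
  imports Defs
begin

subsection \<open>Reflections preserve Lebesgue measure\<close>

text \<open>The obstacle is that the gain of one step is quadratic in the discrepancy, while the
  recursion has to run on expectations. Each step therefore uses the tangent bound
  \<open>z^2 \<ge> 2 a z - a^2\<close> with a free parameter \<open>a\<close>: it is linear in
  \<open>z\<close>, may be averaged as it stands, and the recursion chooses \<open>a\<close>
  afterwards. The square itself arises because superlevel set and ball have equal volume: both
  differences have volume \<open>z / 2\<close>, and each point of one is sent into the other with
  probability at least proportional to that volume.

  The constant \<open>K\<close> does not depend on the level, so integrating over the levels costs
  just one factor, the bound of \<open>f\<close>.

  The estimates are made for Borel \<open>f\<close> on the product of the laws, since the polarized
  function has to be measurable jointly in the reflections and the point. A Lebesgue measurable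
  \<open>f\<close> is exchanged for a Borel representative, which is harmless because reflections
  preserve null sets. The L^1 limit that gives the modulus of the rearrangement is extracted from
  the expectation bound itself: some outcome is no worse than the mean.\<close>

lemma nn_integral_lborel_affine:
  fixes f :: "'a::euclidean_space \<Rightarrow> ennreal"
  assumes [measurable]: "f \<in> borel_measurable borel" and c: "c \<noteq> 0"
  shows "(\<integral>\<^sup>+x. f x \<partial>lborel) = ennreal (\<bar>c\<bar> ^ DIM('a)) * (\<integral>\<^sup>+x. f (t + c *\<^sub>R x) \<partial>lborel)"
  by (subst lborel_affine[OF c, of t])
     (simp add: nn_integral_density nn_integral_distr nn_integral_cmult)

lemma nn_integral_lborel_translate:
  fixes f :: "'a::euclidean_space \<Rightarrow> ennreal"
  assumes "f \<in> borel_measurable borel"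
  shows "(\<integral>\<^sup>+x. f (x + t) \<partial>lborel) = (\<integral>\<^sup>+x. f x \<partial>lborel)"
  using nn_integral_lborel_affine[OF assms, of 1 t] by (simp add: add.commute)

text \<open>Uniqueness of Haar measure, by evaluating \<open>\<integral>\<integral> A(y) B(\<phi> x - y) dy dx\<close> in both orders.\<close>

lemma distr_lborel_eq_lborel:
  fixes \<phi> :: "'a::euclidean_space \<Rightarrow> 'a"
  assumes [measurable]: "\<phi> \<in> borel_measurable borel"
    and trans: "\<And>z. \<exists>z'. \<forall>x. \<phi> x + z = \<phi> (x + z')"
    and ball: "emeasure lborel (\<phi> -` ball 0 1) = emeasure lborel (ball (0::'a) 1)"
  shows "distr lborel borel \<phi> = lborel"
proof (rule measure_eqI)
  fix A :: "'a set" assume "A \<in> sets (distr lborel borel \<phi>)"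
  then have [measurable]: "A \<in> sets borel" by simp
  define B :: "'a set" where "B = ball 0 1"
  have [measurable]: "B \<in> sets borel" by (simp add: B_def)
  let ?a = "indicator A :: 'a \<Rightarrow> ennreal" and ?b = "indicator B :: 'a \<Rightarrow> ennreal"
  \<comment> \<open>\<open>trans\<close> makes the image measure translation invariant: a shift of
    the target is a shift of the source, which Lebesgue measure ignores.\<close>
  have shift: "(\<integral>\<^sup>+x. h (\<phi> x + z) \<partial>lborel) = (\<integral>\<^sup>+x. h (\<phi> x) \<partial>lborel)"
    if [measurable]: "h \<in> borel_measurable borel" for h :: "'a \<Rightarrow> ennreal" and z
  proof -
    obtain z' where z': "\<And>x. \<phi> x + z = \<phi> (x + z')" using trans by blast
    show ?thesis unfolding z' by (rule nn_integral_lborel_translate[where f="\<lambda>x. h (\<phi> x)"]) measurable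
  qed
  have neg: "(\<integral>\<^sup>+y. h y \<partial>lborel) = (\<integral>\<^sup>+w. h (t - w) \<partial>lborel)"
    if "h \<in> borel_measurable borel" for h :: "'a \<Rightarrow> ennreal" and t
    using nn_integral_lborel_affine[OF that, of "-1" t] by simp
  have \<phi>B: "(\<integral>\<^sup>+x. ?b (\<phi> x) \<partial>lborel) = emeasure lborel B"
  proof -
    have "(\<integral>\<^sup>+x. ?b (\<phi> x) \<partial>lborel) = (\<integral>\<^sup>+x. indicator (\<phi> -` B) x \<partial>lborel)"
      by (simp add: indicator_def)
    also have "\<dots> = emeasure lborel (\<phi> -` B)"
      using measurable_sets[OF assms(1), of B] by (intro nn_integral_indicator) simp
    finally show ?thesis using ball by (simp add: B_def)
  qed
  have "emeasure lborel A * emeasure lborel B = (\<integral>\<^sup>+y. ?a y * (\<integral>\<^sup>+x. ?b (\<phi> x + (- y)) \<partial>lborel) \<partial>lborel)"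
    by (subst shift) (simp_all add: \<phi>B nn_integral_multc)
  also have "\<dots> = (\<integral>\<^sup>+y. (\<integral>\<^sup>+x. ?a y * ?b (\<phi> x - y) \<partial>lborel) \<partial>lborel)"
    by (simp add: nn_integral_cmult)
  also have "\<dots> = (\<integral>\<^sup>+x. (\<integral>\<^sup>+y. ?a y * ?b (\<phi> x - y) \<partial>lborel) \<partial>lborel)"
    by (rule lborel_pair.Fubini') measurable
  also have "\<dots> = (\<integral>\<^sup>+x. (\<integral>\<^sup>+w. ?a (\<phi> x - w) * ?b w \<partial>lborel) \<partial>lborel)"
  proof (rule nn_integral_cong)
    fix x
    show "(\<integral>\<^sup>+y. ?a y * ?b (\<phi> x - y) \<partial>lborel) = (\<integral>\<^sup>+w. ?a (\<phi> x - w) * ?b w \<partial>lborel)"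
      by (subst neg[where t="\<phi> x"]) auto
  qed
  also have "\<dots> = (\<integral>\<^sup>+w. (\<integral>\<^sup>+x. ?a (\<phi> x - w) * ?b w \<partial>lborel) \<partial>lborel)"
    by (rule lborel_pair.Fubini') measurable
  also have "\<dots> = (\<integral>\<^sup>+w. (\<integral>\<^sup>+x. ?a (\<phi> x + (- w)) \<partial>lborel) * ?b w \<partial>lborel)"
    by (simp add: nn_integral_multc)
  also have "\<dots> = (\<integral>\<^sup>+x. ?a (\<phi> x) \<partial>lborel) * emeasure lborel B"
    by (subst shift) (simp_all add: nn_integral_cmult)
  finally have eq: "emeasure lborel A * emeasure lborel B = (\<integral>\<^sup>+x. ?a (\<phi> x) \<partial>lborel) * emeasure lborel B" .
  have "emeasure lborel B = ennreal (unit_ball_vol (real DIM('a)))"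
    by (simp add: B_def emeasure_ball)
  then have "emeasure lborel B \<noteq> 0" "emeasure lborel B \<noteq> \<infinity>"
    using unit_ball_vol_pos[of "real DIM('a)"] by (simp_all del: unit_ball_vol_pos)
  with eq have "emeasure lborel A = (\<integral>\<^sup>+x. ?a (\<phi> x) \<partial>lborel)"
    by (metis ennreal_mult_cancel_left infinity_ennreal_def mult.commute)
  also have "\<dots> = (\<integral>\<^sup>+x. ?a x \<partial>distr lborel borel \<phi>)"
    by (rule nn_integral_distr[symmetric]) measurable
  also have "\<dots> = emeasure (distr lborel borel \<phi>) A"
    by simp
  finally show "emeasure (distr lborel borel \<phi>) A = emeasure lborel A" by simp
qed simp

lemma measurable_hyperplane_reflection [measurable (raw)]:
  assumes [measurable]: "a \<in> borel_measurable M" "b \<in> borel_measurable M" "x \<in> borel_measurable M"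
  shows "(\<lambda>w. hyperplane_reflection (a w) (b w) (x w)) \<in> borel_measurable M"
  unfolding hyperplane_reflection_def by measurable

lemma sigma_refl_unit:
  assumes "norm u = 1"
  shows "sigma_refl (r, u) x = x + (r - 2 * (u \<bullet> x)) *\<^sub>R u"
proof -
  have "u \<bullet> u = 1" using assms by (simp add: dot_square_norm)
  then show ?thesis
    by (simp add: sigma_refl_def hyperplane_reflection_def algebra_simps)
qed

lemma sigma_refl_involution:
  assumes "norm u = 1"
  shows "sigma_refl (r, u) (sigma_refl (r, u) x) = x"
proof -
  have "u \<bullet> u = 1" using assms by (simp add: dot_square_norm)
  then show ?thesis
    using assms by (simp add: sigma_refl_unit inner_add_right algebra_simps)
qed

lemma dist_sigma_refl:
  assumes "norm u = 1"
  shows "dist (sigma_refl (r, u) x) (sigma_refl (r, u) y) = dist x y"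
proof -
  have u: "u \<bullet> u = 1" using assms by (simp add: dot_square_norm)
  have "sigma_refl (r, u) x - sigma_refl (r, u) y = (x - y) - (2 * (u \<bullet> (x - y))) *\<^sub>R u"
    using assms by (simp add: sigma_refl_unit algebra_simps inner_diff_right)
  moreover have "(norm ((x - y) - (2 * (u \<bullet> (x - y))) *\<^sub>R u))\<^sup>2 = (norm (x - y))\<^sup>2" 
    unfolding power2_norm_eq_inner
    by (simp only: inner_diff_left[of "x - y"] inner_diff_right[of _ "x - y"] inner_scaleR_left inner_scaleR_right u)
       (simp add: inner_commute algebra_simps)
  ultimately show ?thesis by (simp add: dist_norm)
qed

text \<open>An isometric involution turns translations into translations and pulls the unit ball
  back to a unit ball; the uniqueness argument needs no more.\<close>

lemma distr_sigma_refl: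
  fixes u :: "'a::euclidean_space"
  assumes u: "norm u = 1"
  shows "distr lborel borel (sigma_refl (r, u)) = lborel"
proof (rule distr_lborel_eq_lborel)
  have uu: "u \<bullet> u = 1" using assms by (simp add: dot_square_norm)
  show "sigma_refl (r, u) \<in> borel_measurable borel"
    unfolding sigma_refl_def by measurable
  show "\<exists>z'. \<forall>x. sigma_refl (r, u) x + z = sigma_refl (r, u) (x + z')" for z
    \<comment> \<open>The linear part of the reflection is an involution, so its value at
      \<open>z\<close> is the shift of the source that produces \<open>z\<close>.\<close>
    by (rule exI[of _ "z - (2 * (u \<bullet> z)) *\<^sub>R u"])
       (use u in \<open>simp add: sigma_refl_unit algebra_simps inner_add_right uu\<close>)
  have "sigma_refl (r, u) -` ball 0 1 = ball (sigma_refl (r, u) 0) 1"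
  proof -
    have "dist 0 (sigma_refl (r, u) x) = dist (sigma_refl (r, u) 0) x" for x
      using dist_sigma_refl[OF u, of r "sigma_refl (r, u) 0" x] by (simp add: sigma_refl_involution[OF u])
    then show ?thesis by auto
  qed
  then show "emeasure lborel (sigma_refl (r, u) -` ball 0 1) = emeasure lborel (ball (0::'a) 1)"
    by (simp add: emeasure_ball)
qed

subsection \<open>Polar coordinates\<close>

text \<open>With \<open>a = norm y\<close> this integrates out the auxiliary scale in the polar
  coordinate formula below.\<close>

lemma nn_integral_inverse_power_tail:
  fixes a :: real
  assumes a: "0 < a" and d: "0 < d"
  shows "(\<integral>\<^sup>+s. ennreal (if a < s then 1 / s ^ Suc d else 0) \<partial>lborel) = ennreal (1 / (real d * a ^ d))"
proof -
  have "(\<integral>\<^sup>+s. ennreal (if a < s then 1 / s ^ Suc d else 0) \<partial>lborel) =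
      (\<integral>\<^sup>+s. ennreal (1 / s ^ Suc d) * indicator {a..} s \<partial>lborel)"
    using AE_lborel_singleton[of a]
    by (intro nn_integral_cong_AE) (auto elim!: eventually_mono simp: indicator_def)
  also have "\<dots> = ennreal (0 - (- 1 / (real d * a ^ d)))"
  proof (rule nn_integral_FTC_atLeast[where F="\<lambda>s. - 1 / (real d * s ^ d)"])
    fix x assume "a \<le> x"
    then have x: "0 < x" using a by simp
    have "((\<lambda>s. - 1 / (real d * s ^ d)) has_real_derivative
        (real d * (real d * x ^ (d - 1))) / (real d * x ^ d)\<^sup>2) (at x)"
      using x d by (auto intro!: derivative_eq_intros simp: power2_eq_square)
    also have "(real d * (real d * x ^ (d - 1))) / (real d * x ^ d)\<^sup>2 = 1 / x ^ Suc d"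
    proof -
      define p where "p = x ^ (d - 1)"
      have "x ^ d = x * p" using d by (cases d) (simp_all add: p_def)
      moreover have "0 < p" using x by (simp add: p_def)
      ultimately show ?thesis using x d unfolding p_def[symmetric] by (simp add: power2_eq_square)
    qed
    finally show "((\<lambda>s. - 1 / (real d * s ^ d)) has_real_derivative 1 / x ^ Suc d) (at x)" .
    show "0 \<le> 1 / x ^ Suc d" using x by simp
  next
    have "filterlim (\<lambda>s::real. real d * s ^ d) at_top at_top"
      using d by (intro filterlim_tendsto_pos_mult_at_top[OF tendsto_const] filterlim_pow_at_top filterlim_ident) auto
    then show "((\<lambda>s::real. - 1 / (real d * s ^ d)) \<longlongrightarrow> 0) at_top"
      by (intro tendsto_divide_0[OF tendsto_const] filterlim_at_top_imp_at_infinity)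
  qed measurable
  finally show ?thesis by simp
qed

lemma nn_integral_surface_measure:
  fixes F :: "'a::euclidean_space \<Rightarrow> ennreal"
  assumes [measurable]: "F \<in> borel_measurable borel"
  shows "(\<integral>\<^sup>+u. F u \<partial>surface_measure) =
    of_nat DIM('a) * (\<integral>\<^sup>+x. F (x /\<^sub>R norm x) * indicator (ball 0 1 - {0}) x \<partial>lborel)"
proof -
  have m: "(\<lambda>x::'a. x /\<^sub>R norm x) \<in> restrict_space lborel (ball 0 1 - {0}) \<rightarrow>\<^sub>M restrict_space borel (sphere 0 1)"
    by (intro measurable_restrict_space2 measurable_restrict_space1) (auto simp: space_restrict_space)
  have F: "F \<in> borel_measurable (restrict_space borel (sphere 0 1))"
    by (intro measurable_restrict_space1) measurable
  show ?thesis
    unfolding surface_measure_def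
    using m F by (simp add: nn_integral_scale_measure nn_integral_distr nn_integral_restrict_space)
qed

text \<open>The sphere carries the cone measure, so an integral over directions is \<open>d\<close>
  times an integral over the unit ball. Substituting \<open>t = s * norm x\<close> on each ray, and
  then \<open>y = s x\<close> at each scale \<open>s\<close>, leaves for \<open>y \<noteq> 0\<close>
  the weight \<open>norm y ^ d / s ^ (d + 1)\<close>, integrated over \<open>s > norm y\<close>.
  This equals \<open>1 / d\<close> and cancels the factor.\<close>

lemma nn_integral_polar:
  fixes f :: "'a::euclidean_space \<Rightarrow> ennreal"
  assumes [measurable]: "f \<in> borel_measurable borel"
  shows "(\<integral>\<^sup>+u. (\<integral>\<^sup>+t. ennreal (if 0 < t then t ^ (DIM('a) - 1) else 0) * f (t *\<^sub>R u) \<partial>lborel) \<partial>surface_measure) =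
    (\<integral>\<^sup>+x. f x \<partial>lborel)" (is "(\<integral>\<^sup>+u. ?F u \<partial>_) = _")
proof -
  let ?d = "DIM('a)"
  define e where "e = ?d - 1"
  have de: "?d = Suc e" by (simp add: e_def)
  let ?i = "indicator (ball 0 1 - {0}) :: 'a \<Rightarrow> ennreal"
  have Fm [measurable]: "?F \<in> borel_measurable borel" by measurable
  have F_scale: "?F (x /\<^sub>R norm x) * ?i x =
      (\<integral>\<^sup>+s. ennreal (if 0 < s \<and> 0 < norm x \<and> norm x < 1 then s ^ e * norm x ^ ?d else 0) * f (s *\<^sub>R x) \<partial>lborel)" for x :: 'a
  proof (cases "x \<noteq> 0 \<and> norm x < 1")
    case True
    then have "?F (x /\<^sub>R norm x) = ennreal \<bar>norm x\<bar> *
      (\<integral>\<^sup>+s. ennreal (if 0 < 0 + norm x * s then (0 + norm x * s) ^ e else 0) * f ((0 + norm x * s) *\<^sub>R (x /\<^sub>R norm x)) \<partial>lborel)"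
      unfolding e_def[symmetric] by (intro nn_integral_real_affine) auto
    also have "\<dots> = (\<integral>\<^sup>+s. ennreal \<bar>norm x\<bar> * (ennreal (if 0 < 0 + norm x * s then (0 + norm x * s) ^ e else 0) *
        f ((0 + norm x * s) *\<^sub>R (x /\<^sub>R norm x))) \<partial>lborel)"
      by (rule nn_integral_cmult[symmetric]) measurable
    also have "\<dots> = (\<integral>\<^sup>+s. ennreal (if 0 < s \<and> 0 < norm x \<and> norm x < 1 then s ^ e * norm x ^ ?d else 0) * f (s *\<^sub>R x) \<partial>lborel)"
    proof (rule nn_integral_cong)
      fix s :: real
      have 1: "(0 + norm x * s) *\<^sub>R (x /\<^sub>R norm x) = s *\<^sub>R x" using True by simp
      have 2: "ennreal \<bar>norm x\<bar> * ennreal (if 0 < 0 + norm x * s then (0 + norm x * s) ^ e else 0) =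
          ennreal (if 0 < s \<and> 0 < norm x \<and> norm x < 1 then s ^ e * norm x ^ ?d else 0)"
        using True unfolding de
        by (subst ennreal_mult[symmetric]) (auto simp: zero_less_mult_iff power_mult_distrib)
      show "ennreal \<bar>norm x\<bar> * (ennreal (if 0 < 0 + norm x * s then (0 + norm x * s) ^ e else 0) *
          f ((0 + norm x * s) *\<^sub>R (x /\<^sub>R norm x))) =
          ennreal (if 0 < s \<and> 0 < norm x \<and> norm x < 1 then s ^ e * norm x ^ ?d else 0) * f (s *\<^sub>R x)"
        unfolding 1 2[symmetric] by (simp add: mult.assoc)
    qed
    finally show ?thesis using True by simp
  next
    case False
    then show ?thesis by (auto simp: indicator_def)
  qed
  have x_scale: "(\<integral>\<^sup>+x. ennreal (if 0 < s \<and> 0 < norm x \<and> norm x < 1 then s ^ e * norm x ^ ?d else 0) * f (s *\<^sub>R x) \<partial>lborel) =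
      (\<integral>\<^sup>+y. ennreal (if 0 < norm y \<and> norm y < s then norm y ^ ?d / s ^ Suc ?d else 0) * f y \<partial>lborel)" for s :: real
  proof (cases "0 < s")
    case True
    let ?k = "\<lambda>x. ennreal (if 0 < s \<and> 0 < norm x \<and> norm x < 1 then s ^ e * norm x ^ ?d else 0) * f (s *\<^sub>R x)"
    have "(\<integral>\<^sup>+x. ?k x \<partial>lborel) = ennreal (\<bar>1 / s\<bar> ^ ?d) * (\<integral>\<^sup>+x. ?k (0 + (1 / s) *\<^sub>R x) \<partial>lborel)"
      using True by (intro nn_integral_lborel_affine) auto
    also have "\<dots> = (\<integral>\<^sup>+x. ennreal (\<bar>1 / s\<bar> ^ ?d) * ?k (0 + (1 / s) *\<^sub>R x) \<partial>lborel)"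
      by (rule nn_integral_cmult[symmetric]) measurable
    also have "\<dots> = (\<integral>\<^sup>+y. ennreal (if 0 < norm y \<and> norm y < s then norm y ^ ?d / s ^ Suc ?d else 0) * f y \<partial>lborel)"
    proof (intro nn_integral_cong)
      fix y :: 'a
      have "(1 / s) ^ ?d * (s ^ e * (norm y / s) ^ ?d) = norm y ^ ?d / s ^ Suc ?d"
        using True unfolding de by (simp add: power_divide field_simps)
      then show "ennreal (\<bar>1 / s\<bar> ^ ?d) * ?k (0 + (1 / s) *\<^sub>R y) =
          ennreal (if 0 < norm y \<and> norm y < s then norm y ^ ?d / s ^ Suc ?d else 0) * f y"
        using True by (auto simp: mult.assoc[symmetric] ennreal_mult[symmetric])
    qed
    finally show ?thesis .
  next
    case False
    then have "\<not> norm y < s" for y :: 'a using norm_ge_zero[of y] by linarith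
    with False show ?thesis by simp
  qed
  have s_int: "(\<integral>\<^sup>+s. ennreal (if 0 < norm y \<and> norm y < s then norm y ^ ?d / s ^ Suc ?d else 0) \<partial>lborel) =
      ennreal (1 / ?d)" if "y \<noteq> 0" for y :: 'a
  proof -
    have "(\<integral>\<^sup>+s. ennreal (if 0 < norm y \<and> norm y < s then norm y ^ ?d / s ^ Suc ?d else 0) \<partial>lborel) =
        (\<integral>\<^sup>+s. ennreal (norm y ^ ?d) * ennreal (if norm y < s then 1 / s ^ Suc ?d else 0) \<partial>lborel)"
      using that by (intro nn_integral_cong) (auto simp: ennreal_mult'[symmetric])
    also have "\<dots> = ennreal (norm y ^ ?d) * ennreal (1 / (real ?d * norm y ^ ?d))"
      using nn_integral_inverse_power_tail[of "norm y" ?d] that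
      by (subst nn_integral_cmult, measurable)
    also have "\<dots> = ennreal (1 / ?d)"
      using that by (subst ennreal_mult'[symmetric]) auto
    finally show ?thesis .
  qed
  have "(\<integral>\<^sup>+u. ?F u \<partial>surface_measure) = of_nat ?d * (\<integral>\<^sup>+x. ?F (x /\<^sub>R norm x) * ?i x \<partial>lborel)"
    by (rule nn_integral_surface_measure) measurable
  also have "\<dots> = of_nat ?d * (\<integral>\<^sup>+x. (\<integral>\<^sup>+s. ennreal (if 0 < s \<and> 0 < norm x \<and> norm x < 1 then s ^ e * norm x ^ ?d else 0) * f (s *\<^sub>R x) \<partial>lborel) \<partial>lborel)"
    unfolding F_scale ..
  also have "(\<integral>\<^sup>+x. (\<integral>\<^sup>+s. ennreal (if 0 < s \<and> 0 < norm x \<and> norm x < 1 then s ^ e * norm x ^ ?d else 0) * f (s *\<^sub>R x) \<partial>lborel) \<partial>lborel)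
      = (\<integral>\<^sup>+s. (\<integral>\<^sup>+x. ennreal (if 0 < s \<and> 0 < norm x \<and> norm x < 1 then s ^ e * norm x ^ ?d else 0) * f (s *\<^sub>R x) \<partial>lborel) \<partial>lborel)"
    by (rule lborel_pair.Fubini') measurable
  also have "\<dots> = (\<integral>\<^sup>+s. (\<integral>\<^sup>+y. ennreal (if 0 < norm y \<and> norm y < s then norm y ^ ?d / s ^ Suc ?d else 0) * f y \<partial>lborel) \<partial>lborel)"
    unfolding x_scale ..
  also have "\<dots> = (\<integral>\<^sup>+y. (\<integral>\<^sup>+s. ennreal (if 0 < norm y \<and> norm y < s then norm y ^ ?d / s ^ Suc ?d else 0) * f y \<partial>lborel) \<partial>lborel)"
    by (rule lborel_pair.Fubini') measurable
  also have "\<dots> = (\<integral>\<^sup>+y. ennreal (1 / ?d) * f y \<partial>lborel)"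
  proof (rule nn_integral_cong_AE)
    show "AE y in lborel. (\<integral>\<^sup>+s. ennreal (if 0 < norm y \<and> norm y < s then norm y ^ ?d / s ^ Suc ?d else 0) * f y \<partial>lborel) =
        ennreal (1 / ?d) * f y"
      using AE_lborel_singleton[of "0::'a"]
    proof eventually_elim
      fix y :: 'a assume "y \<noteq> 0"
      then show "(\<integral>\<^sup>+s. ennreal (if 0 < norm y \<and> norm y < s then norm y ^ ?d / s ^ Suc ?d else 0) * f y \<partial>lborel) =
        ennreal (1 / ?d) * f y"
        by (subst nn_integral_multc, measurable) (simp only: s_int not_False_eq_True)
    qed
  qed
  also have "\<dots> = ennreal (1 / ?d) * (\<integral>\<^sup>+y. f y \<partial>lborel)"
    by (rule nn_integral_cmult) measurable
  also have "of_nat ?d * (ennreal (1 / ?d) * (\<integral>\<^sup>+y. f y \<partial>lborel)) = (\<integral>\<^sup>+y. f y \<partial>lborel)"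
    by (simp add: mult.assoc[symmetric] ennreal_of_nat_eq_real_of_nat ennreal_mult[symmetric])
  finally show ?thesis .
qed

subsection \<open>The law of a random reflection\<close>

lemma space_reflection_measure:
  "space (reflection_measure L :: (real \<times> 'a::euclidean_space) measure) = {0<..<2 * L} \<times> sphere 0 1"
  by (simp add: reflection_measure_def space_pair_measure space_restrict_space)

lemma space_uniform_reflection:
  "space (uniform_reflection L :: (real \<times> 'a::euclidean_space) measure) = {0<..<2 * L} \<times> sphere 0 1"
  by (simp add: uniform_reflection_def space_reflection_measure)

lemma sets_uniform_reflection:
  "sets (uniform_reflection L :: (real \<times> 'a::euclidean_space) measure) = sets (reflection_measure L)"
  by (simp add: uniform_reflection_def)

lemma measurable_ident_reflection_measure:
  "(\<lambda>w. w) \<in> (reflection_measure L :: (real \<times> 'a::euclidean_space) measure) \<rightarrow>\<^sub>M borel"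
proof -
  have 1: "(\<lambda>r. r) \<in> restrict_space lborel {0<..<2 * L} \<rightarrow>\<^sub>M borel"
    by (intro measurable_restrict_space1) simp
  have "(\<lambda>u. u) \<in> restrict_space borel (sphere (0::'a) 1) \<rightarrow>\<^sub>M borel"
    by (intro measurable_restrict_space1) simp
  then have 2: "(\<lambda>u::'a. u) \<in> surface_measure \<rightarrow>\<^sub>M borel"
    by (simp add: measurable_cong_sets[OF sets_surface_measure refl])
  have "(\<lambda>w. (fst w, snd w)) \<in> (reflection_measure L :: (real \<times> 'a) measure) \<rightarrow>\<^sub>M borel \<Otimes>\<^sub>M borel"
    unfolding reflection_measure_def
    by (intro measurable_Pair measurable_compose[OF measurable_fst 1] measurable_compose[OF measurable_snd 2])
  then show ?thesis by (simp add: borel_prod)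
qed

lemma measurable_ident_uniform_reflection [measurable]:
  "(\<lambda>w. w) \<in> (uniform_reflection L :: (real \<times> 'a::euclidean_space) measure) \<rightarrow>\<^sub>M borel"
  using measurable_ident_reflection_measure
  by (simp add: measurable_cong_sets[OF sets_uniform_reflection refl])

lemma measurable_sigma_refl [measurable (raw)]:
  fixes x :: "'b \<Rightarrow> 'a::euclidean_space"
  assumes [measurable]: "w \<in> M \<rightarrow>\<^sub>M borel" "x \<in> M \<rightarrow>\<^sub>M borel"
  shows "(\<lambda>z. sigma_refl (w z) (x z)) \<in> M \<rightarrow>\<^sub>M borel"
proof -
  have [measurable]: "fst \<in> (borel :: (real \<times> 'a) measure) \<rightarrow>\<^sub>M borel" "snd \<in> (borel :: (real \<times> 'a) measure) \<rightarrow>\<^sub>M borel"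
    unfolding borel_prod[symmetric] by measurable
  show ?thesis unfolding sigma_refl_def by measurable
qed

lemma emeasure_reflection_measure_space:
  assumes "0 < L"
  shows "emeasure (reflection_measure L :: (real \<times> 'a::euclidean_space) measure) (space (reflection_measure L)) =
    ennreal (2 * L * (real DIM('a) * unit_ball_vol (real DIM('a))))"
proof -
  interpret S: finite_measure "surface_measure :: 'a measure"
    by (rule finite_measureI) (simp add: emeasure_surface_measure_space)
  have "emeasure (reflection_measure L :: (real \<times> 'a) measure) (space (reflection_measure L)) =
      ennreal (2 * L) * ennreal (real DIM('a) * unit_ball_vol (real DIM('a)))"
    unfolding reflection_measure_def space_pair_measure
    using assms by (subst S.emeasure_pair_measure_Times)
      (auto simp: sets_restrict_space_iff space_restrict_space emeasure_restrict_space sets_surface_measure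
        emeasure_surface_measure_space[symmetric])
  also have "\<dots> = ennreal (2 * L * (real DIM('a) * unit_ball_vol (real DIM('a))))"
    using assms by (intro ennreal_mult[symmetric]) auto
  finally show ?thesis .
qed

text \<open>The normalising constant stands on the left so that no quotient of extended reals has to
  be carried along. The radius is integrated innermost because, for a fixed direction, the image of
  a point moves along a line as \<open>r\<close> varies.\<close>

lemma nn_integral_uniform_reflection:
  fixes f :: "real \<times> 'a::euclidean_space \<Rightarrow> ennreal"
  assumes L: "0 < L" and f: "f \<in> borel_measurable borel"
  shows "ennreal (2 * L * (real DIM('a) * unit_ball_vol (real DIM('a)))) * (\<integral>\<^sup>+w. f w \<partial>uniform_reflection L) =
    (\<integral>\<^sup>+u. (\<integral>\<^sup>+r. f (r, u) * indicator {0<..<2 * L} r \<partial>lborel) \<partial>surface_measure)"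
proof -
  let ?R = "reflection_measure L :: (real \<times> 'a) measure"
  let ?c = "2 * L * (real DIM('a) * unit_ball_vol (real DIM('a)))"
  interpret S: finite_measure "surface_measure :: 'a measure"
    by (rule finite_measureI) (simp add: emeasure_surface_measure_space)
  interpret I: finite_measure "restrict_space lborel {0<..<2 * L}"
    using L by (intro finite_measureI) (simp add: space_restrict_space emeasure_restrict_space)
  interpret P: pair_sigma_finite "restrict_space lborel {0<..<2 * L}" "surface_measure :: 'a measure" ..
  have c: "0 < ?c" using L by simp
  have fR: "f \<in> borel_measurable ?R"
    using measurable_compose[OF measurable_ident_reflection_measure f] .
  have "(\<integral>\<^sup>+w. f w \<partial>uniform_reflection L) = (\<integral>\<^sup>+w. f w * indicator (space ?R) w \<partial>?R) / emeasure ?R (space ?R)"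
    unfolding uniform_reflection_def using fR by (intro nn_integral_uniform_measure) auto
  also have "(\<integral>\<^sup>+w. f w * indicator (space ?R) w \<partial>?R) = (\<integral>\<^sup>+w. f w \<partial>?R)"
    by (intro nn_integral_cong) simp
  also have "\<dots> = (\<integral>\<^sup>+u. (\<integral>\<^sup>+r. f (r, u) \<partial>restrict_space lborel {0<..<2 * L}) \<partial>surface_measure)"
    using P.nn_integral_snd[of f] fR by (simp add: reflection_measure_def)
  also have "\<dots> = (\<integral>\<^sup>+u. (\<integral>\<^sup>+r. f (r, u) * indicator {0<..<2 * L} r \<partial>lborel) \<partial>surface_measure)"
    by (subst nn_integral_restrict_space) auto
  finally have "(\<integral>\<^sup>+w. f w \<partial>uniform_reflection L) = \<dots> / ennreal ?c"
    unfolding emeasure_reflection_measure_space[OF L] .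
  moreover have "ennreal k * (a / ennreal k) = a" if "0 < k" for k a
    using that by (subst ennreal_times_divide, subst mult.commute) (auto intro!: ennreal_mult_divide_eq)
  ultimately show ?thesis using c by presburger
qed

text \<open>On the region \<open>\<bar>x\<bar> < \<bar>y\<bar>\<close> the point \<open>\<sigma>\<^sub>\<omega> x\<close> has density proportional to \<open>\<bar>x - y\<bar> powr (1 - d)\<close>,
  because \<open>\<sigma>\<^sub>\<omega> x = x + t u\<close> with \<open>t = r - 2 (u \<bullet> x)\<close>: these are polar coordinates around \<open>x\<close>.\<close>

lemma emeasure_le_hitting_probability:
  fixes x :: "'a::euclidean_space"
  assumes L: "0 < L" and Y [measurable]: "Y \<in> sets borel"
    and xY: "\<And>y. y \<in> Y \<Longrightarrow> norm x < norm y \<and> norm y \<le> L"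
  shows "emeasure lborel Y \<le> ennreal (real DIM('a) * unit_ball_vol (real DIM('a)) * (2 * L) ^ DIM('a)) *
    (\<integral>\<^sup>+w. indicator Y (sigma_refl w x) \<partial>uniform_reflection L)"
proof -
  let ?d = "DIM('a)"
  define e where "e = ?d - 1"
  have de: "?d = Suc e" by (simp add: e_def)
  let ?I = "\<lambda>u. \<integral>\<^sup>+r. indicator Y (sigma_refl (r, u) x) * indicator {0<..<2 * L} r \<partial>lborel"
  let ?J = "\<lambda>u. \<integral>\<^sup>+t. ennreal (if 0 < t then t ^ e else 0) * indicator Y (x + t *\<^sub>R u) \<partial>lborel"
  have J_le: "?J u \<le> ennreal ((2 * L) ^ e) * ?I u" if u: "norm u = 1" for u :: 'a
  proof -
    have uu: "u \<bullet> u = 1" using u by (simp add: dot_square_norm)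
    have "(\<lambda>r. indicator Y (sigma_refl (r, u) x) * indicator {0<..<2 * L} r :: ennreal) \<in> borel_measurable borel"
      by measurable
    then have "?I u = ennreal \<bar>1\<bar> * (\<integral>\<^sup>+t. indicator Y (sigma_refl (2 * (u \<bullet> x) + 1 * t, u) x) * indicator {0<..<2 * L} (2 * (u \<bullet> x) + 1 * t) \<partial>lborel)"
      by (rule nn_integral_real_affine) simp
    also have "\<dots> = (\<integral>\<^sup>+t. indicator Y (x + t *\<^sub>R u) * indicator {0<..<2 * L} (2 * (u \<bullet> x) + t) \<partial>lborel)"
      by (simp add: sigma_refl_unit[OF u])
    finally have I: "?I u = \<dots>" .
    have "?J u \<le> (\<integral>\<^sup>+t. ennreal ((2 * L) ^ e) * (indicator Y (x + t *\<^sub>R u) * indicator {0<..<2 * L} (2 * (u \<bullet> x) + t)) \<partial>lborel)"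
    proof (rule nn_integral_mono)
      fix t :: real
      show "ennreal (if 0 < t then t ^ e else 0) * indicator Y (x + t *\<^sub>R u) \<le>
        ennreal ((2 * L) ^ e) * (indicator Y (x + t *\<^sub>R u) * indicator {0<..<2 * L} (2 * (u \<bullet> x) + t))"
      proof (cases "0 < t \<and> x + t *\<^sub>R u \<in> Y")
        case True
        define y where "y = x + t *\<^sub>R u"
        have y: "norm x < norm y" "norm y \<le> L" using xY True by (auto simp: y_def)
        have t: "t = norm (y - x)" using True u by (simp add: y_def)
        have tb: "t \<le> norm y + norm x" unfolding t by (rule norm_triangle_ineq4)
        have dy: "norm y - norm x \<le> t" unfolding t by (rule norm_triangle_ineq2)
        \<comment> \<open>With \<open>r = 2 (u \<bullet> x) + t\<close> this reads
          \<open>|y|^2 - |x|^2 = t r\<close> and places \<open>r\<close> in the interval of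
          admissible radii: \<open>r > 0\<close> because \<open>y\<close> is farther out, and
          \<open>r \<le> |x| + |y| < 2 L\<close> because \<open>|y| - |x| \<le> t\<close>.\<close>
        have "(norm y)\<^sup>2 = (norm x)\<^sup>2 + t * (2 * (u \<bullet> x) + t)"
          unfolding y_def power2_norm_eq_inner
          by (simp add: inner_add_left inner_add_right uu inner_commute algebra_simps)
        then have tr: "t * (2 * (u \<bullet> x) + t) = (norm y - norm x) * (norm y + norm x)"
          by (simp add: power2_eq_square algebra_simps)
        also have "\<dots> > 0" using y norm_ge_zero[of x] by (intro mult_pos_pos) linarith+
        finally have r0: "0 < 2 * (u \<bullet> x) + t" using True by (simp add: zero_less_mult_iff)
        have "t * (2 * (u \<bullet> x) + t) \<le> t * (norm y + norm x)"
          unfolding tr using dy by (intro mult_right_mono) auto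
        then have "2 * (u \<bullet> x) + t \<le> norm y + norm x" using True by simp
        then have r1: "2 * (u \<bullet> x) + t < 2 * L" using y by linarith
        \<comment> \<open>The Jacobian of polar coordinates is replaced by a bound on its range;
          with the length \<open>2 L\<close> of the interval of radii it produces
          \<open>(2 L) ^ d\<close>.\<close>
        have "t ^ e \<le> (2 * L) ^ e" using True tb y by (intro power_mono) auto
        then show ?thesis using True r0 r1 by (simp add: ennreal_leI)
      next
        case False
        then show ?thesis by auto
      qed
    qed
    also have "\<dots> = ennreal ((2 * L) ^ e) * ?I u"
      unfolding I by (rule nn_integral_cmult) measurable
    finally show ?thesis .
  qed
  have "emeasure lborel Y = (\<integral>\<^sup>+z. indicator Y (z + x) \<partial>lborel)"
    by (subst nn_integral_lborel_translate) auto
  also have "\<dots> = (\<integral>\<^sup>+z. indicator Y (x + z) \<partial>lborel)"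
    by (simp add: add.commute)
  also have "\<dots> = (\<integral>\<^sup>+u. ?J u \<partial>surface_measure)"
    unfolding e_def by (rule nn_integral_polar[symmetric]) measurable
  also have "\<dots> \<le> (\<integral>\<^sup>+u. ennreal ((2 * L) ^ e) * ?I u \<partial>surface_measure)"
    by (intro nn_integral_mono J_le) simp
  also have "\<dots> = ennreal ((2 * L) ^ e) * (\<integral>\<^sup>+u. ?I u \<partial>surface_measure)"
  proof (rule nn_integral_cmult)
    have "(\<lambda>u. u) \<in> restrict_space borel (sphere (0::'a) 1) \<rightarrow>\<^sub>M borel"
      by (intro measurable_restrict_space1) simp
    then have [measurable]: "(\<lambda>u::'a. u) \<in> surface_measure \<rightarrow>\<^sub>M borel"
      by (simp add: measurable_cong_sets[OF sets_surface_measure refl])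
    have "?I \<in> borel_measurable borel" by measurable
    from measurable_compose[OF _ this] show "?I \<in> borel_measurable surface_measure" by measurable
  qed
  also have "(\<integral>\<^sup>+u. ?I u \<partial>surface_measure) =
      ennreal (2 * L * (real ?d * unit_ball_vol (real ?d))) * (\<integral>\<^sup>+w. indicator Y (sigma_refl w x) \<partial>uniform_reflection L)"
    by (rule nn_integral_uniform_reflection[OF L, symmetric]) measurable
  also have "ennreal ((2 * L) ^ e) * (ennreal (2 * L * (real ?d * unit_ball_vol (real ?d))) * (\<integral>\<^sup>+w. indicator Y (sigma_refl w x) \<partial>uniform_reflection L)) =
     ennreal (real ?d * unit_ball_vol (real ?d) * (2 * L) ^ ?d) * (\<integral>\<^sup>+w. indicator Y (sigma_refl w x) \<partial>uniform_reflection L)"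
  proof -
    have "(2 * L) ^ e * (2 * L * (real ?d * unit_ball_vol (real ?d))) = real ?d * unit_ball_vol (real ?d) * (2 * L) ^ ?d"
      unfolding de by simp
    moreover have "ennreal ((2 * L) ^ e) * ennreal (2 * L * (real ?d * unit_ball_vol (real ?d))) =
        ennreal ((2 * L) ^ e * (2 * L * (real ?d * unit_ball_vol (real ?d))))"
      using L by (intro ennreal_mult[symmetric]) auto
    ultimately show ?thesis by (metis mult.assoc)
  qed
  finally show ?thesis .
qed

subsection \<open>The drop of the symmetric difference\<close>

text \<open>A polarization acts separately on each pair of mirror points. Since the reflection
  preserves measure, an integral is half the integral of the pair sums, so it is enough to compare
  pair by pair.\<close>

lemma nn_integral_le_of_paired_le:
  fixes F G :: "'a::euclidean_space \<Rightarrow> ennreal"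
  assumes u: "norm u = 1"
    and [measurable]: "F \<in> borel_measurable borel" "G \<in> borel_measurable borel"
    and le: "\<And>x. F x + F (sigma_refl (r, u) x) \<le> G x + G (sigma_refl (r, u) x)"
  shows "(\<integral>\<^sup>+x. F x \<partial>lborel) \<le> (\<integral>\<^sup>+x. G x \<partial>lborel)"
proof -
  have [measurable]: "sigma_refl (r, u) \<in> borel_measurable borel" by measurable
  have 2: "(\<integral>\<^sup>+x. h x + h (sigma_refl (r, u) x) \<partial>lborel) = 2 * (\<integral>\<^sup>+x. h x \<partial>lborel)"
    if [measurable]: "h \<in> borel_measurable borel" for h :: "'a \<Rightarrow> ennreal"
  proof -
    have "(\<integral>\<^sup>+x. h (sigma_refl (r, u) x) \<partial>lborel) = (\<integral>\<^sup>+x. h x \<partial>distr lborel borel (sigma_refl (r, u)))"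
      by (rule nn_integral_distr[symmetric]) measurable
    then show ?thesis by (simp add: nn_integral_add distr_sigma_refl[OF u] mult_2)
  qed
  have "2 * (\<integral>\<^sup>+x. F x \<partial>lborel) \<le> 2 * (\<integral>\<^sup>+x. G x \<partial>lborel)"
    unfolding 2[OF assms(2), symmetric] 2[OF assms(3), symmetric] by (rule nn_integral_mono) (rule le)
  then show ?thesis by (simp add: ennreal_mult_le_mult_iff)
qed

text \<open>Function, reflection and point all depend on the parameter, and \<open>f\<close> is only
  evaluated along two measurable curves of points, so that the rule can be iterated over random
  reflections.\<close>

lemma measurable_polarization [measurable (raw)]:
  fixes f :: "'c \<Rightarrow> 'a::euclidean_space \<Rightarrow> real"
  assumes [measurable]: "w \<in> M \<rightarrow>\<^sub>M borel" "x \<in> M \<rightarrow>\<^sub>M borel"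
    and "(\<lambda>z. f z (x z)) \<in> borel_measurable M" "(\<lambda>z. f z (sigma_refl (w z) (x z))) \<in> borel_measurable M"
  shows "(\<lambda>z. polarization (w z) (f z) (x z)) \<in> borel_measurable M"
  unfolding polarization_def using assms(3,4) by measurable

text \<open>Polarization at most exchanges the two values of a mirror pair. A pair with equal norms
  is a single fixed point, so ties do no harm.\<close>

lemma emeasure_polarization_superlevel:
  fixes f :: "'a::euclidean_space \<Rightarrow> real"
  assumes u: "norm u = 1" and r: "0 < r" and [measurable]: "f \<in> borel_measurable borel"
  shows "emeasure lborel {x. t < polarization (r, u) f x} = emeasure lborel {x. t < f x}"
proof -
  let ?\<sigma> = "sigma_refl (r, u)" and ?h = "polarization (r, u) f"
  note fx = sigma_refl_eq_norm_iff[OF u r]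
  have hm [measurable]: "?h \<in> borel_measurable borel" by measurable
  have e: "emeasure lborel {x. t < g x} = (\<integral>\<^sup>+x. of_bool (t < g x) \<partial>lborel)"
    if [measurable]: "g \<in> borel_measurable borel" for g :: "'a \<Rightarrow> real"
  proof -
    have "{x. t < g x} \<in> sets lborel" by measurable
    then have "(\<integral>\<^sup>+x. indicator {x. t < g x} x \<partial>lborel) = emeasure lborel {x. t < g x}"
      by (rule nn_integral_indicator)
    then show ?thesis by (simp add: indicator_def)
  qed
  have pair: "of_bool (t < ?h x) + of_bool (t < ?h (?\<sigma> x)) = (of_bool (t < f x) + of_bool (t < f (?\<sigma> x)) :: ennreal)" for x
    using fx[of x] unfolding polarization_def sigma_refl_involution[OF u]
    by (cases "norm x" "norm (?\<sigma> x)" rule: linorder_cases) (auto simp: max_def min_def)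
  show ?thesis unfolding e[OF hm] e[OF assms(3)]
    by (intro antisym nn_integral_le_of_paired_le[OF u, where r=r]) (simp_all add: pair)
qed

text \<open>The volume of a symmetric difference, written as the integral of the disagreement of two
  predicates: in this form it is measurable in any parameter of \<open>f\<close> and matches the
  layers of an L^1 distance.\<close>

definition ball_discrepancy :: "real \<Rightarrow> real \<Rightarrow> ('a::euclidean_space \<Rightarrow> real) \<Rightarrow> ennreal" where
  "ball_discrepancy \<rho> t f = (\<integral>\<^sup>+x. of_bool ((t < f x) \<noteq> (norm x < \<rho>)) \<partial>lborel)"

text \<open>Ball and polarized function both favour the nearer point of each pair. A pair changes
  its contribution only if the ball contains its nearer point alone and the superlevel set its
  farther point alone. Then both mismatches vanish, while the second integrand counts the pair once,
  at its nearer point; hence the factor 2.\<close>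

lemma ball_discrepancy_polarization:
  fixes f :: "'a::euclidean_space \<Rightarrow> real"
  assumes u: "norm u = 1" and r: "0 < r" and [measurable]: "f \<in> borel_measurable borel"
  shows "ball_discrepancy \<rho> t (polarization (r, u) f) +
      2 * (\<integral>\<^sup>+x. of_bool (norm x < \<rho> \<and> \<not> t < f x) * indicator {y. \<rho> \<le> norm y \<and> t < f y} (sigma_refl (r, u) x) \<partial>lborel)
    \<le> ball_discrepancy \<rho> t f"
proof -
  let ?\<sigma> = "sigma_refl (r, u)" and ?h = "polarization (r, u) f"
  note fx = sigma_refl_eq_norm_iff[OF u r]
  have hm [measurable]: "?h \<in> borel_measurable borel" by measurable
  let ?T = "\<lambda>x. of_bool (norm x < \<rho> \<and> \<not> t < f x) * indicator {y. \<rho> \<le> norm y \<and> t < f y} (?\<sigma> x) :: ennreal"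
  have "ball_discrepancy \<rho> t ?h + 2 * (\<integral>\<^sup>+x. ?T x \<partial>lborel) = (\<integral>\<^sup>+x. of_bool ((t < ?h x) \<noteq> (norm x < \<rho>)) + 2 * ?T x \<partial>lborel)"
    unfolding ball_discrepancy_def by (simp add: nn_integral_add nn_integral_cmult)
  also have "\<dots> \<le> (\<integral>\<^sup>+x. of_bool ((t < f x) \<noteq> (norm x < \<rho>)) \<partial>lborel)"
  proof (rule nn_integral_le_of_paired_le[OF u, of _ _ r])
    fix x :: 'a
    have T: "?T y = of_bool (norm y < \<rho> \<and> \<not> t < f y \<and> \<rho> \<le> norm (?\<sigma> y) \<and> t < f (?\<sigma> y))" for y
      by (auto simp: indicator_def)
    show "of_bool ((t < ?h x) \<noteq> (norm x < \<rho>)) + 2 * ?T x + (of_bool ((t < ?h (?\<sigma> x)) \<noteq> (norm (?\<sigma> x) < \<rho>)) + 2 * ?T (?\<sigma> x)) \<le>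
        of_bool ((t < f x) \<noteq> (norm x < \<rho>)) + of_bool ((t < f (?\<sigma> x)) \<noteq> (norm (?\<sigma> x) < \<rho>))"
      using fx[of x] unfolding T polarization_def sigma_refl_involution[OF u]
      by (cases "norm x" "norm (?\<sigma> x)" rule: linorder_cases; cases "t < f x"; cases "t < f (?\<sigma> x)"; cases "norm x < \<rho>"; cases "norm (?\<sigma> x) < \<rho>")
        (simp_all add: less_max_iff_disj)
  qed measurable
  finally show ?thesis by (simp add: ball_discrepancy_def)
qed

text \<open>Here \<open>2 p\<close> is the present discrepancy \<open>z\<close>, \<open>E\<close>
  the expected next one and \<open>2 S\<close> the expected loss, so \<open>hit\<close> says
  \<open>z^2 / K \<le> 2 S\<close>. Subtracted terms are moved to the other side, because
  subtraction of extended reals truncates.\<close>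

lemma drop_arithmetic:
  fixes E S :: ennreal
  assumes K: "0 < K" and p: "0 \<le> p" and a: "0 \<le> a"
    and hit: "ennreal p * ennreal p \<le> ennreal (K / 2) * S"
    and drop: "E + 2 * S \<le> ennreal (2 * p)"
  shows "E + ennreal (2 * a / K) * ennreal (2 * p) \<le> ennreal (2 * p) + ennreal (a\<^sup>2 / K)"
proof -
  have fin: "E \<noteq> top" "S \<noteq> top"
    using drop by (auto simp: top_unique)
  obtain z where z: "0 \<le> z" "E = ennreal z" using fin(1) by (metis ennreal_cases)
  obtain s where s: "0 \<le> s" "S = ennreal s" using fin(2) by (metis ennreal_cases)
  have "ennreal (p * p) \<le> ennreal (K / 2 * s)"
    using hit p(1) s K ennreal_mult[of "K / 2" s] by (simp add: ennreal_mult[of p p])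
  then have h: "p * p \<le> K / 2 * s" using s K by (subst (asm) ennreal_le_iff) auto
  have "ennreal (z + 2 * s) = ennreal z + 2 * ennreal s"
    using z s by (simp add: ennreal_mult)
  then have "ennreal (z + 2 * s) \<le> ennreal (2 * p)" using drop z s by simp
  then have v: "z + 2 * s \<le> 2 * p" using p by (subst (asm) ennreal_le_iff) auto
  \<comment> \<open>The square lies above its tangent at \<open>a\<close>.\<close>
  have "0 \<le> (2 * p - a)\<^sup>2" by simp
  then have "2 * a * (2 * p) \<le> 4 * (p * p) + a\<^sup>2" by (simp add: power2_eq_square algebra_simps)
  also have "\<dots> \<le> K * (2 * s) + a\<^sup>2" using h by simp
  finally have "2 * a / K * (2 * p) \<le> 2 * s + a\<^sup>2 / K" using K by (simp add: field_simps)
  with v have "z + 2 * a / K * (2 * p) \<le> 2 * p + a\<^sup>2 / K" by linarith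
  then have "ennreal (z + 2 * a / K * (2 * p)) \<le> ennreal (2 * p + a\<^sup>2 / K)" by (rule ennreal_leI)
  moreover have "ennreal (z + 2 * a / K * (2 * p)) = ennreal z + ennreal (2 * a / K * (2 * p))"
    using z p a K by (intro ennreal_plus) auto
  moreover have "ennreal (2 * a / K * (2 * p)) = ennreal (2 * a / K) * ennreal (2 * p)"
    using p a K by (intro ennreal_mult) auto
  moreover have "ennreal (2 * p + a\<^sup>2 / K) = ennreal (2 * p) + ennreal (a\<^sup>2 / K)"
    using p K by (intro ennreal_plus) auto
  ultimately show ?thesis unfolding z(2) by simp
qed

text \<open>Equal volumes of superlevel set and ball force the differences \<open>X\<close> and
  \<open>Y\<close> to have a common volume \<open>p\<close>. Each point of \<open>X\<close> hits
  \<open>Y\<close> with probability at least \<open>p / (K / 2)\<close>, and integrating over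
  \<open>X\<close> gives the square of \<open>p\<close>.\<close>

lemma ball_discrepancy_step:
  fixes f :: "'a::euclidean_space \<Rightarrow> real"
  assumes L: "0 < L" and f [measurable]: "f \<in> borel_measurable borel"
    and supp: "\<And>x. t < f x \<Longrightarrow> norm x \<le> L"
    and vol: "emeasure lborel {x. t < f x} = emeasure lborel (ball (0::'a) \<rho>)"
    and a: "0 \<le> a"
  defines "K \<equiv> 2 * (real DIM('a) * unit_ball_vol (real DIM('a)) * (2 * L) ^ DIM('a))"
  shows "(\<integral>\<^sup>+w. ball_discrepancy \<rho> t (polarization w f) \<partial>uniform_reflection L) + ennreal (2 * a / K) * ball_discrepancy \<rho> t f
    \<le> ball_discrepancy \<rho> t f + ennreal (a\<^sup>2 / K)"
proof -
  let ?U = "uniform_reflection L :: (real \<times> 'a) measure"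
  interpret U: prob_space ?U by (rule prob_space_uniform_reflection[OF L])
  interpret P: pair_sigma_finite lborel ?U ..
  have K: "0 < K" using L by (simp add: K_def)
  define X where "X = {x. norm x < \<rho> \<and> \<not> t < f x}"
  define Y where "Y = {x. \<rho> \<le> norm x \<and> t < f x}"
  define Z where "Z = {x. norm x < \<rho> \<and> t < f x}"
  have [measurable]: "X \<in> sets borel" "Y \<in> sets borel" "Z \<in> sets borel"
    unfolding X_def Y_def Z_def by measurable
  have fin: "emeasure lborel (ball (0::'a) \<rho>) < \<infinity>" by (rule emeasure_lborel_ball_finite)
  have XZ: "emeasure lborel X + emeasure lborel Z = emeasure lborel (ball (0::'a) \<rho>)"
    by (subst plus_emeasure) (auto simp: X_def Z_def intro!: arg_cong[where f="emeasure lborel"])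
  have YZ: "emeasure lborel Y + emeasure lborel Z = emeasure lborel {x. t < f x}"
    by (subst plus_emeasure) (auto simp: Y_def Z_def intro!: arg_cong[where f="emeasure lborel"])
  have Zfin: "emeasure lborel Z \<noteq> top" using XZ fin by (metis ennreal_add_eq_top infinity_ennreal_def less_irrefl)
  have "emeasure lborel X = emeasure lborel Y"
  proof -
    have "emeasure lborel Z + emeasure lborel X = emeasure lborel Z + emeasure lborel Y"
      using XZ YZ vol by (simp only: add.commute)
    then show ?thesis using Zfin by (simp add: ennreal_add_left_cancel)
  qed
  moreover have "emeasure lborel X \<noteq> top" using XZ fin by (metis ennreal_add_eq_top infinity_ennreal_def less_irrefl)
  ultimately obtain p where p: "0 \<le> p" "emeasure lborel X = ennreal p" "emeasure lborel Y = ennreal p"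
    by (metis ennreal_cases)
  have D: "ball_discrepancy \<rho> t f = ennreal (2 * p)"
  proof -
    have "ball_discrepancy \<rho> t f = (\<integral>\<^sup>+x. indicator X x + indicator Y x \<partial>lborel)"
      unfolding ball_discrepancy_def X_def Y_def by (intro nn_integral_cong) (auto simp: indicator_def)
    also have "\<dots> = ennreal p + ennreal p"
      using p by (simp add: nn_integral_add)
    finally show ?thesis using p by (simp add: ennreal_plus[symmetric] del: ennreal_plus)
  qed
  let ?T = "\<lambda>w. \<integral>\<^sup>+x. indicator X x * indicator Y (sigma_refl w x) \<partial>lborel"
  have drop: "ball_discrepancy \<rho> t (polarization w f) + 2 * ?T w \<le> ennreal (2 * p)" if ws: "w \<in> space ?U" for w
  proof -
    obtain r u where w: "w = (r, u)" "norm u = 1" "0 < r" using ws by (cases w) (auto simp: space_uniform_reflection)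
    show ?thesis
      using ball_discrepancy_polarization[OF w(2,3) f, of \<rho> t] unfolding D w(1)
      by (simp add: X_def Y_def indicator_def[of "{x. norm x < \<rho> \<and> \<not> t < f x}"])
  qed
  have hit: "ennreal p * ennreal p \<le> ennreal (K / 2) * (\<integral>\<^sup>+w. ?T w \<partial>?U)"
  proof -
    have "ennreal p * ennreal p = (\<integral>\<^sup>+x. indicator X x * ennreal p \<partial>lborel)"
      using p by (simp add: nn_integral_multc)
    also have "\<dots> \<le> (\<integral>\<^sup>+x. ennreal (K / 2) * (\<integral>\<^sup>+w. indicator X x * indicator Y (sigma_refl w x) \<partial>?U) \<partial>lborel)"
    proof (rule nn_integral_mono)
      fix x :: 'a
      show "indicator X x * ennreal p \<le> ennreal (K / 2) * (\<integral>\<^sup>+w. indicator X x * indicator Y (sigma_refl w x) \<partial>?U)"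
      proof (cases "x \<in> X")
        case True
        \<comment> \<open>\<open>X\<close> lies inside the ball and \<open>Y\<close> outside, so the
          sphere of radius \<open>\<rho>\<close> separates them.\<close>
        have "norm x < norm y \<and> norm y \<le> L" if "y \<in> Y" for y
          using True that supp by (auto simp: X_def Y_def)
        then have "emeasure lborel Y \<le> ennreal (K / 2) * (\<integral>\<^sup>+w. indicator Y (sigma_refl w x) \<partial>?U)"
          using emeasure_le_hitting_probability[OF L, of Y x] by (simp add: K_def)
        then show ?thesis using True p by simp
      qed simp
    qed
    also have "\<dots> = ennreal (K / 2) * (\<integral>\<^sup>+x. (\<integral>\<^sup>+w. indicator X x * indicator Y (sigma_refl w x) \<partial>?U) \<partial>lborel)"
      by (rule nn_integral_cmult) measurable
    also have "(\<integral>\<^sup>+x. (\<integral>\<^sup>+w. indicator X x * indicator Y (sigma_refl w x) \<partial>?U) \<partial>lborel) = (\<integral>\<^sup>+w. ?T w \<partial>?U)"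
      by (rule P.Fubini'[symmetric]) measurable
    finally show ?thesis .
  qed
  have Dm [measurable]: "(\<lambda>w. ball_discrepancy \<rho> t (polarization w f)) \<in> borel_measurable ?U"
    unfolding ball_discrepancy_def by measurable
  have avg: "(\<integral>\<^sup>+w. ball_discrepancy \<rho> t (polarization w f) \<partial>?U) + 2 * (\<integral>\<^sup>+w. ?T w \<partial>?U) \<le> ennreal (2 * p)"
  proof -
    have "(\<integral>\<^sup>+w. ball_discrepancy \<rho> t (polarization w f) \<partial>?U) + 2 * (\<integral>\<^sup>+w. ?T w \<partial>?U) =
        (\<integral>\<^sup>+w. ball_discrepancy \<rho> t (polarization w f) + 2 * ?T w \<partial>?U)"
      by (subst nn_integral_add, measurable) (subst nn_integral_cmult, measurable)
    also have "\<dots> \<le> (\<integral>\<^sup>+w. ennreal (2 * p) \<partial>?U)"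
      by (rule nn_integral_mono) (rule drop)
    finally show ?thesis by (simp add: U.emeasure_space_1)
  qed
  show ?thesis
    using drop_arithmetic[OF K p(1) a hit avg] unfolding D .
qed

subsection \<open>Random sequences of polarizations\<close>

definition admissible :: "(real \<times> 'a::euclidean_space) list \<Rightarrow> bool" where
  "admissible ws \<longleftrightarrow> (\<forall>w\<in>set ws. 0 < fst w \<and> norm (snd w) = 1)"

lemma polarizations_Nil [simp]: "polarizations [] f = f"
  by (simp add: polarizations_def)

lemma polarizations_snoc [simp]: "polarizations (ws @ [w]) f = polarization w (polarizations ws f)"
  by (simp add: polarizations_def)

lemma admissible_snoc [simp]: "admissible (ws @ [w]) \<longleftrightarrow> admissible ws \<and> 0 < fst w \<and> norm (snd w) = 1"
  by (auto simp: admissible_def)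

text \<open>The point is an arbitrary measurable function in the induction, because the last
  polarization evaluates the earlier ones also at a reflected, hence random, point.\<close>

lemma measurable_polarizations:
  fixes f :: "'a::euclidean_space \<Rightarrow> real"
  assumes f: "f \<in> borel_measurable borel"
    and W: "\<And>i. i \<in> set is \<Longrightarrow> W i \<in> N \<rightarrow>\<^sub>M borel"
    and x: "x \<in> N \<rightarrow>\<^sub>M borel"
  shows "(\<lambda>z. polarizations (map (\<lambda>i. W i z) is) f (x z)) \<in> borel_measurable N"
  using W x
proof (induction "is" arbitrary: x rule: rev_induct)
  case Nil
  then show ?case using f by simp
next
  case (snoc i js)
  have m: "W i \<in> N \<rightarrow>\<^sub>M borel" "x \<in> N \<rightarrow>\<^sub>M borel" using snoc.prems by auto
  have "(\<lambda>z. polarizations (map (\<lambda>i. W i z) js) f (y z)) \<in> borel_measurable N" if "y \<in> N \<rightarrow>\<^sub>M borel" for y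
    by (rule snoc.IH) (use snoc.prems that in auto)
  then show ?case
    unfolding map_append list.map polarizations_snoc
    using m measurable_sigma_refl[OF m] by (intro measurable_polarization) blast+
qed

lemma borel_measurable_polarizations [measurable]:
  fixes f :: "'a::euclidean_space \<Rightarrow> real"
  assumes "f \<in> borel_measurable borel"
  shows "polarizations ws f \<in> borel_measurable borel"
  using measurable_polarizations[OF assms, of ws "\<lambda>w _. w" borel "\<lambda>x. x"] by simp

lemma measurable_polarizations_PiM:
  fixes f :: "'a::euclidean_space \<Rightarrow> real"
  assumes "f \<in> borel_measurable borel" and y: "y \<in> N \<rightarrow>\<^sub>M borel" and \<xi>: "\<xi> \<in> N \<rightarrow>\<^sub>M (\<Pi>\<^sub>M i\<in>{1..n}. uniform_reflection L)"
  shows "(\<lambda>p. polarizations (map (\<xi> p) [1..<Suc n]) f (y p)) \<in> borel_measurable N"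
proof (rule measurable_polarizations[OF assms(1) _ y])
  fix i assume "i \<in> set [1..<Suc n]"
  then have "i \<in> {1..n}" by auto
  then have "(\<lambda>p. \<xi> p i) \<in> N \<rightarrow>\<^sub>M uniform_reflection L"
    using measurable_compose[OF \<xi> measurable_component_singleton] by blast
  then show "(\<lambda>p. \<xi> p i) \<in> N \<rightarrow>\<^sub>M borel"
    using measurable_compose[OF _ measurable_ident_uniform_reflection] by blast
qed

lemma admissible_PiM:
  assumes "x \<in> space (\<Pi>\<^sub>M i\<in>{1..n}. (uniform_reflection L :: (real \<times> 'a::euclidean_space) measure))"
  shows "admissible (map x [1..<Suc n])"
proof -
  have "x i \<in> {0<..<2 * L} \<times> sphere 0 1" if "i \<in> {1..n}" for i
    using assms that by (auto simp: space_PiM space_uniform_reflection PiE_iff)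
  then show ?thesis by (fastforce simp: admissible_def mem_Times_iff)
qed

lemma emeasure_polarizations_superlevel:
  fixes f :: "'a::euclidean_space \<Rightarrow> real"
  assumes "f \<in> borel_measurable borel" "admissible ws"
  shows "emeasure lborel {x. t < polarizations ws f x} = emeasure lborel {x. t < f x}"
  using assms(2)
proof (induction ws rule: rev_induct)
  case (snoc w ws)
  then show ?case
    using emeasure_polarization_superlevel[of "snd w" "fst w" "polarizations ws f" t]
      borel_measurable_polarizations[OF assms(1)] by simp
qed simp

text \<open>Large values only move inward: the value of the mirror point can replace a smaller one
  only where that mirror point is at least as far from the origin.\<close>

lemma polarizations_superlevel_norm_le:
  assumes "\<And>x. t < f x \<Longrightarrow> norm x \<le> L" "t < polarizations ws f x"
  shows "norm x \<le> L"
  using assms(2)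
proof (induction ws arbitrary: x rule: rev_induct)
  case (snoc w ws)
  then show ?case
    by (force simp: polarization_def less_max_iff_disj split: if_splits)
qed (simp add: assms(1))

lemma polarizations_bounds:
  assumes "\<And>x. a \<le> f x" "\<And>x. f x \<le> b"
  shows "a \<le> polarizations ws f x" "polarizations ws f x \<le> b"
proof -
  have "a \<le> polarizations ws f x \<and> polarizations ws f x \<le> b"
    by (induction ws arbitrary: x rule: rev_induct) (simp_all add: assms polarization_def le_max_iff_disj min_le_iff_disj)
  then show "a \<le> polarizations ws f x" "polarizations ws f x \<le> b" by auto
qed

section \<open>The recursion for the expected discrepancy\<close>

lemma ball_discrepancy_finite:
  fixes f :: "'a::euclidean_space \<Rightarrow> real"
  assumes [measurable]: "f \<in> borel_measurable borel"
    and vol: "emeasure lborel {x. t < f x} = emeasure lborel (ball (0::'a) \<rho>)"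
  shows "ball_discrepancy \<rho> t f < top"
proof -
  have [measurable]: "{x. t < f x} \<in> sets borel" by measurable
  have "ball_discrepancy \<rho> t f \<le> (\<integral>\<^sup>+x. indicator {x. t < f x} x + indicator (ball 0 \<rho>) x \<partial>lborel)"
    unfolding ball_discrepancy_def by (intro nn_integral_mono) (auto simp: indicator_def)
  also have "\<dots> = emeasure lborel {x. t < f x} + emeasure lborel (ball (0::'a) \<rho>)"
    by (subst nn_integral_add) (simp_all add: borel_measurable_indicator)
  also have "\<dots> < top"
    using vol emeasure_lborel_ball_finite[of "0::'a" \<rho>] by simp
  finally show ?thesis .
qed

text \<open>A discrete form of \<open>z' = - z^2 / K\<close>, whose solutions lie below
  \<open>K / n\<close> for every finite initial value.\<close>

lemma recursion_bound:
  fixes z :: "nat \<Rightarrow> ennreal"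
  assumes K: "0 < K" and z0: "z 0 < top"
    and step: "\<And>n a. 0 \<le> a \<Longrightarrow> z (Suc n) + ennreal (2 * a / K) * z n \<le> z n + ennreal (a\<^sup>2 / K)"
  shows "1 \<le> n \<Longrightarrow> z n \<le> ennreal (K / real n)"
proof (induction n)
  case (Suc n)
  have "z n < top" using Suc.IH z0 by (cases "n = 0") (auto simp: order_le_less_trans)
  then obtain x where x: "0 \<le> x" "z n = ennreal x" by (metis ennreal_cases less_irrefl)
  \<comment> \<open>The tangent is taken at the bound to be proved, which turns the contraction
    \<open>2 a / K\<close> into \<open>2 / (n + 1)\<close>.\<close>
  define a where "a = K / real (Suc n)"
  have a: "0 \<le> a" using K by (simp add: a_def)
  have s: "z (Suc n) + ennreal (2 * a / K) * ennreal x \<le> ennreal x + ennreal (a\<^sup>2 / K)"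
    using step[OF a, of n] x by simp
  then have "z (Suc n) \<noteq> top" by (auto simp: top_unique)
  then obtain y where y: "0 \<le> y" "z (Suc n) = ennreal y" by (metis ennreal_cases)
  have "ennreal (y + 2 * a / K * x) \<le> ennreal (x + a\<^sup>2 / K)"
  proof -
    have "ennreal (y + 2 * a / K * x) = ennreal y + ennreal (2 * a / K * x)"
      using y x a K by (intro ennreal_plus) auto
    also have "ennreal (2 * a / K * x) = ennreal (2 * a / K) * ennreal x"
      using x a K by (intro ennreal_mult) auto
    also have "ennreal y + \<dots> \<le> ennreal x + ennreal (a\<^sup>2 / K)" using s y by simp
    also have "\<dots> = ennreal (x + a\<^sup>2 / K)"
      using x K by (intro ennreal_plus[symmetric]) auto
    finally show ?thesis .
  qed
  then have le: "y + 2 * a / K * x \<le> x + a\<^sup>2 / K" using x K by (subst (asm) ennreal_le_iff) auto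
  have e: "2 * a / K = 2 / real (Suc n)" "a\<^sup>2 / K = K / (real (Suc n))\<^sup>2"
    using K unfolding a_def power2_eq_square by (simp_all del: of_nat_Suc)
  have "y \<le> K / real (Suc n)"
  proof (cases "n = 0")
    \<comment> \<open>Here \<open>2 a / K = 2\<close>, so the step reads
      \<open>y + 2 x \<le> x + K\<close>: the first bound is \<open>K\<close>, however large the
      finite \<open>z 0\<close> is.\<close>
    case True
    then show ?thesis using le x unfolding e by simp
  next
    case False
    define m where "m = real n"
    have m: "1 \<le> m" using False by (simp add: m_def)
    have xm: "x \<le> K / m" using Suc.IH False x K by (simp add: m_def)
    have Sm: "real (Suc n) = m + 1" by (simp add: m_def)
    have "y \<le> x * ((m - 1) / (m + 1)) + K / (m + 1)\<^sup>2"
    proof -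
      have q: "(m - 1) / (m + 1) = 1 - 2 / (m + 1)" using m by (simp add: field_simps)
      show ?thesis using le unfolding e Sm q by (simp add: algebra_simps)
    qed
    \<comment> \<open>The coefficient of \<open>x\<close> is nonnegative for
      \<open>m \<ge> 1\<close>, so the induction hypothesis can be inserted. What remains is
      \<open>m^2 + m - 1 \<le> m^2 + m\<close>.\<close>
    also have "\<dots> \<le> K / m * ((m - 1) / (m + 1)) + K / (m + 1)\<^sup>2"
      using xm m by (intro add_mono mult_right_mono) auto
    also have "\<dots> = K * ((m - 1) * (m + 1) + m) / (m * (m + 1)\<^sup>2)"
      using m by (simp add: divide_simps power2_eq_square) (simp add: algebra_simps)
    also have "\<dots> \<le> K * (m * (m + 1)) / (m * (m + 1)\<^sup>2)"
      using m K by (intro divide_right_mono mult_left_mono) (auto simp: algebra_simps)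
    also have "\<dots> = K / (m + 1)" using m by (simp add: power2_eq_square)
    finally show ?thesis unfolding Sm .
  qed
  then show ?case unfolding y(2) by (rule ennreal_leI)
qed simp

text \<open>On the product space, conditioning on the first \<open>n\<close> reflections is the
  iterated integral over \<open>insert (Suc n) {1..n}\<close>. The one-step estimate bounds the
  inner integral for each fixed past, with one \<open>a\<close> for all pasts.\<close>

lemma expected_ball_discrepancy_le:
  fixes f :: "'a::euclidean_space \<Rightarrow> real"
  assumes L: "0 < L" and f [measurable]: "f \<in> borel_measurable borel"
    and supp: "\<And>x. t < f x \<Longrightarrow> norm x \<le> L"
    and vol: "emeasure lborel {x. t < f x} = emeasure lborel (ball (0::'a) \<rho>)"
    and n: "1 \<le> n"
  defines "K \<equiv> 2 * (real DIM('a) * unit_ball_vol (real DIM('a)) * (2 * L) ^ DIM('a))"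
  shows "(\<integral>\<^sup>+x. ball_discrepancy \<rho> t (polarizations (map x [1..<Suc n]) f) \<partial>(\<Pi>\<^sub>M i\<in>{1..n}. uniform_reflection L)) \<le> ennreal (K / real n)"
proof -
  let ?U = "uniform_reflection L :: (real \<times> 'a) measure"
  interpret U: prob_space ?U by (rule prob_space_uniform_reflection[OF L])
  interpret product_sigma_finite "\<lambda>_::nat. ?U" ..
  let ?P = "\<lambda>n. \<Pi>\<^sub>M i\<in>{1..n}. ?U"
  let ?D = "\<lambda>n x. ball_discrepancy \<rho> t (polarizations (map x [1..<Suc n]) f)"
  define z where "z n = (\<integral>\<^sup>+x. ?D n x \<partial>?P n)" for n
  have K: "0 < K" using L by (simp add: K_def)
  have meas: "?D n \<in> borel_measurable (?P n)" for n
  proof -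
    have [measurable]: "(\<lambda>p. polarizations (map (fst p) [1..<Suc n]) f (snd p)) \<in> borel_measurable (?P n \<Otimes>\<^sub>M lborel)"
      by (rule measurable_polarizations_PiM[OF f]) auto
    show ?thesis unfolding ball_discrepancy_def by measurable
  qed
  have step: "z (Suc n) + ennreal (2 * a / K) * z n \<le> z n + ennreal (a\<^sup>2 / K)" if a: "0 \<le> a" for n a
  proof -
    interpret Pn: prob_space "?P n" by (rule prob_space_PiM) (rule U.prob_space_axioms)
    have ins: "{1..Suc n} = insert (Suc n) {1..n}" by auto
    have "z (Suc n) = (\<integral>\<^sup>+x. (\<integral>\<^sup>+w. ?D (Suc n) (x(Suc n := w)) \<partial>?U) \<partial>?P n)"
      unfolding z_def using meas[of "Suc n"] unfolding ins by (intro product_nn_integral_insert) auto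
    also have "\<dots> = (\<integral>\<^sup>+x. (\<integral>\<^sup>+w. ball_discrepancy \<rho> t (polarization w (polarizations (map x [1..<Suc n]) f)) \<partial>?U) \<partial>?P n)"
    proof (intro nn_integral_cong)
      fix x :: "nat \<Rightarrow> real \<times> 'a" and w
      have "map (x(Suc n := w)) [1..<Suc (Suc n)] = map x [1..<Suc n] @ [w]" by simp
      then show "?D (Suc n) (x(Suc n := w)) = ball_discrepancy \<rho> t (polarization w (polarizations (map x [1..<Suc n]) f))"
        by (simp only: polarizations_snoc)
    qed
    finally have zS: "z (Suc n) = (\<integral>\<^sup>+x. (\<integral>\<^sup>+w. ball_discrepancy \<rho> t (polarization w (polarizations (map x [1..<Suc n]) f)) \<partial>?U) \<partial>?P n)" .
    let ?E = "\<lambda>x. \<integral>\<^sup>+w. ball_discrepancy \<rho> t (polarization w (polarizations (map x [1..<Suc n]) f)) \<partial>?U"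
    have "z (Suc n) + ennreal (2 * a / K) * z n \<le> (\<integral>\<^sup>+x. ?E x + ennreal (2 * a / K) * ?D n x \<partial>?P n)"
    proof -
      have "ennreal (2 * a / K) * z n = (\<integral>\<^sup>+x. ennreal (2 * a / K) * ?D n x \<partial>?P n)"
        unfolding z_def by (rule nn_integral_cmult[symmetric]) (rule meas)
      moreover have "(\<integral>\<^sup>+x. ?E x \<partial>?P n) + (\<integral>\<^sup>+x. ennreal (2 * a / K) * ?D n x \<partial>?P n) = (\<integral>\<^sup>+x. ?E x + ennreal (2 * a / K) * ?D n x \<partial>?P n)"
      proof (rule nn_integral_add[symmetric])
        have 1: "(\<lambda>p. ?D (Suc n) ((fst p)(Suc n := snd p))) \<in> borel_measurable (?P n \<Otimes>\<^sub>M ?U)"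
        proof (rule measurable_compose[OF _ meas])
          show "(\<lambda>p. (fst p)(Suc n := snd p)) \<in> ?P n \<Otimes>\<^sub>M ?U \<rightarrow>\<^sub>M ?P (Suc n)"
            unfolding ins by (rule measurable_fun_upd[where J="{1..n}"]) auto
        qed
        have 2: "?D (Suc n) ((fst p)(Suc n := snd p)) = ball_discrepancy \<rho> t (polarization (snd p) (polarizations (map (fst p) [1..<Suc n]) f))" for p
        proof -
          have "map ((fst p)(Suc n := snd p)) [1..<Suc (Suc n)] = map (fst p) [1..<Suc n] @ [snd p]" by simp
          then show ?thesis by (simp only: polarizations_snoc)
        qed
        show "?E \<in> borel_measurable (?P n)"
          using 1 unfolding 2 by (intro U.borel_measurable_nn_integral) (simp add: case_prod_beta')
        show "(\<lambda>x. ennreal (2 * a / K) * ?D n x) \<in> borel_measurable (?P n)"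
          using meas[of n] by measurable
      qed
      ultimately show ?thesis unfolding zS by simp
    qed
    also have "\<dots> \<le> (\<integral>\<^sup>+x. ?D n x + ennreal (a\<^sup>2 / K) \<partial>?P n)"
    proof (rule nn_integral_mono)
      fix x assume x: "x \<in> space (?P n)"
      note ad = admissible_PiM[OF x]
      let ?g = "polarizations (map x [1..<Suc n]) f"
      show "?E x + ennreal (2 * a / K) * ?D n x \<le> ?D n x + ennreal (a\<^sup>2 / K)"
        unfolding K_def
      \<comment> \<open>The volume of the superlevel set is unchanged by earlier polarizations and
        the set stays within radius \<open>L\<close>, so the same \<open>\<rho>\<close> and
        \<open>K\<close> serve at every step.\<close>
      proof (rule ball_discrepancy_step[OF L _ _ _ a])
        show "?g \<in> borel_measurable borel" by (rule borel_measurable_polarizations[OF f])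
        show "norm y \<le> L" if "t < ?g y" for y
          using polarizations_superlevel_norm_le[OF supp that] .
        show "emeasure lborel {y. t < ?g y} = emeasure lborel (ball (0::'a) \<rho>)"
          using emeasure_polarizations_superlevel[OF f ad] vol by simp
      qed
    qed
    also have "\<dots> = z n + ennreal (a\<^sup>2 / K)"
      unfolding z_def by (subst nn_integral_add[OF meas]) (simp_all only: nn_integral_const Pn.emeasure_space_1 mult_1_right borel_measurable_const)
    finally show ?thesis .
  qed
  \<comment> \<open>The product over no indices is a single point, so \<open>z 0\<close> is the
    discrepancy of \<open>f\<close> itself.\<close>
  have "z 0 < top"
    using ball_discrepancy_finite[OF f vol] by (simp add: z_def PiM_empty)
  from recursion_bound[OF K this step n] show ?thesis unfolding z_def .
qed

subsection \<open>Expected distance in the mean\<close>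

text \<open>Only layers \<open>t > 0\<close> occur, since these are the levels at which the
  rearrangement is characterised; the layer \<open>t = 0\<close> is a null set.\<close>

lemma abs_diff_layer_cake:
  fixes a b :: real
  assumes "0 \<le> a" "0 \<le> b"
  shows "ennreal \<bar>a - b\<bar> = (\<integral>\<^sup>+t. indicator {0<..} t * of_bool ((t < a) \<noteq> (t < b)) \<partial>lborel)"
proof -
  have "(\<integral>\<^sup>+t. indicator {0<..} t * of_bool ((t < a) \<noteq> (t < b)) \<partial>lborel) = (\<integral>\<^sup>+t. indicator {min a b..<max a b} t \<partial>lborel)"
    using AE_lborel_singleton[of "0::real"] assms
    by (intro nn_integral_cong_AE) (auto elim!: eventually_mono simp: indicator_def min_def max_def)
  also have "\<dots> = ennreal (max a b - min a b)"
    by simp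
  also have "max a b - min a b = \<bar>a - b\<bar>" by auto
  finally show ?thesis ..
qed

lemma borel_measurable_lower_semicontinuous:
  fixes g :: "'a::euclidean_space \<Rightarrow> real"
  assumes "lower_semicontinuous g"
  shows "g \<in> borel_measurable borel"
  using assms unfolding lower_semicontinuous_def
  by (intro borel_measurableI_greater) auto

lemma emeasure_superlevel_finite:
  fixes f :: "'a::euclidean_space \<Rightarrow> real"
  assumes supp: "\<And>x. f x \<noteq> 0 \<Longrightarrow> norm x \<le> L" and t: "0 \<le> t"
  shows "emeasure lebesgue {x. t < f x} < \<infinity>"
proof -
  have "emeasure lebesgue {x. t < f x} \<le> emeasure lebesgue (cball (0::'a) L)"
    using supp t by (intro emeasure_mono) force+
  also have "\<dots> < \<infinity>" using emeasure_lborel_cball_finite[of "0::'a" L] by simp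
  finally show ?thesis .
qed

lemma is_symm_decr_rearrangement_level:
  fixes f :: "'a::euclidean_space \<Rightarrow> real"
  assumes g: "is_symm_decr_rearrangement f g" and [measurable]: "f \<in> borel_measurable borel"
    and supp: "\<And>x. f x \<noteq> 0 \<Longrightarrow> norm x \<le> L" and t: "0 < t"
  obtains \<rho> where "0 \<le> \<rho>" "{x. t < g x} = ball 0 \<rho>" "emeasure lborel {x. t < f x} = emeasure lborel (ball (0::'a) \<rho>)"
proof -
  have A: "{x. t < f x} \<in> sets lborel" by measurable
  obtain \<rho> where \<rho>: "0 \<le> \<rho>" "symm_set {x. t < f x} = ball 0 \<rho>" "emeasure lebesgue (ball (0::'a) \<rho>) = emeasure lebesgue {x. t < f x}"
    using symm_set_ball[OF emeasure_superlevel_finite[of f L t]] supp t by auto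
  show ?thesis
    by (rule that[of \<rho>]) (use \<rho> A g t in \<open>auto simp: is_symm_decr_rearrangement_def\<close>)
qed

text \<open>The superlevel set of \<open>g\<close> is the centred ball with the volume of that of
  \<open>f\<close>, so each layer of the L^1 distance is a \<open>ball_discrepancy\<close>. Its
  expectation is at most \<open>K / n\<close> for every \<open>t\<close> between \<open>0\<close>
  and \<open>m\<close>.\<close>

lemma expected_L1_distance_le:
  fixes f :: "'a::euclidean_space \<Rightarrow> real"
  assumes L: "0 < L" and f [measurable]: "f \<in> borel_measurable borel"
    and f0: "\<And>x. 0 \<le> f x" and fm: "\<And>x. f x \<le> m"
    and supp: "\<And>x. f x \<noteq> 0 \<Longrightarrow> norm x \<le> L"
    and g: "is_symm_decr_rearrangement f g"
    and n: "1 \<le> n"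
  defines "K \<equiv> 2 * (real DIM('a) * unit_ball_vol (real DIM('a)) * (2 * L) ^ DIM('a))"
  shows "(\<integral>\<^sup>+x. (\<integral>\<^sup>+y. ennreal \<bar>polarizations (map x [1..<Suc n]) f y - g y\<bar> \<partial>lborel) \<partial>(\<Pi>\<^sub>M i\<in>{1..n}. uniform_reflection L))
    \<le> ennreal (K / real n) * ennreal m"
proof -
  let ?U = "uniform_reflection L :: (real \<times> 'a) measure"
  let ?P = "\<Pi>\<^sub>M i\<in>{1..n}. ?U"
  interpret U: prob_space ?U by (rule prob_space_uniform_reflection[OF L])
  interpret P: prob_space ?P by (rule prob_space_PiM) (rule U.prob_space_axioms)
  interpret PL: pair_sigma_finite ?P "lborel :: real measure" ..
  let ?S = "\<lambda>x. polarizations (map x [1..<Suc n]) f"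
  have [measurable]: "g \<in> borel_measurable borel"
    using g by (intro borel_measurable_lower_semicontinuous) (simp add: is_symm_decr_rearrangement_def)
  have g0: "0 \<le> g y" for y using g by (simp add: is_symm_decr_rearrangement_def)
  have m0: "0 \<le> m" using f0 fm order_trans by blast
  have Sm [measurable (raw)]: "(\<lambda>p. ?S (\<xi> p) (y p)) \<in> borel_measurable N"
    if "\<xi> \<in> N \<rightarrow>\<^sub>M ?P" "y \<in> N \<rightarrow>\<^sub>M borel" for N :: "'c measure" and \<xi> y
    using measurable_polarizations_PiM[OF f that(2,1)] .
  let ?J = "\<lambda>x t. indicator {0<..} t * (\<integral>\<^sup>+y. of_bool ((t < ?S x y) \<noteq> (t < g y)) \<partial>lborel)"
  have J: "(\<integral>\<^sup>+y. ennreal \<bar>?S x y - g y\<bar> \<partial>lborel) = (\<integral>\<^sup>+t. ?J x t \<partial>lborel)" for x :: "nat \<Rightarrow> real \<times> 'a"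
  proof -
    have [measurable]: "?S x \<in> borel_measurable borel" by (rule borel_measurable_polarizations[OF f])
    have "(\<integral>\<^sup>+y. ennreal \<bar>?S x y - g y\<bar> \<partial>lborel) =
        (\<integral>\<^sup>+y. (\<integral>\<^sup>+t. indicator {0<..} t * of_bool ((t < ?S x y) \<noteq> (t < g y)) \<partial>lborel) \<partial>lborel)"
      by (intro nn_integral_cong abs_diff_layer_cake polarizations_bounds(1)[OF f0 fm] g0)
    also have "\<dots> = (\<integral>\<^sup>+t. (\<integral>\<^sup>+y. indicator {0<..} t * of_bool ((t < ?S x y) \<noteq> (t < g y)) \<partial>lborel) \<partial>lborel)"
      by (rule lborel_pair.Fubini') measurable
    also have "\<dots> = (\<integral>\<^sup>+t. ?J x t \<partial>lborel)"
      by (intro nn_integral_cong nn_integral_cmult) measurable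
    finally show ?thesis .
  qed
  have JP: "(\<integral>\<^sup>+x. ?J x t \<partial>?P) \<le> ennreal (K / real n) * indicator {0<..<m} t" for t
  proof (cases "0 < t \<and> t < m")
    case True
    then obtain \<rho> where \<rho>: "0 \<le> \<rho>" "{x. t < g x} = ball 0 \<rho>" "emeasure lborel {x. t < f x} = emeasure lborel (ball (0::'a) \<rho>)"
      using is_symm_decr_rearrangement_level[OF g f supp] by blast
    have gt: "t < g y \<longleftrightarrow> norm y < \<rho>" for y using \<rho>(2) by auto
    have "norm x \<le> L" if "t < f x" for x using supp that True by force
    from expected_ball_discrepancy_le[OF L f this \<rho>(3) n] True show ?thesis
      by (simp add: ball_discrepancy_def gt K_def del: upt_Suc)
  next
    case False
    \<comment> \<open>Above \<open>m\<close> both superlevel sets are empty, that of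
      \<open>g\<close> because it is a ball of volume zero.\<close>
    have J0: "?J x t = 0" for x :: "nat \<Rightarrow> real \<times> 'a"
    proof (cases "0 < t")
      case True
      then have t: "m \<le> t" using False by simp
      then have nf: "\<not> t < f y" for y using fm[of y] by linarith
      obtain \<rho> where \<rho>: "0 \<le> \<rho>" "{x. t < g x} = ball 0 \<rho>" "emeasure lborel {x. t < f x} = emeasure lborel (ball (0::'a) \<rho>)"
        using True is_symm_decr_rearrangement_level[OF g f supp] by blast
      have "emeasure lborel (ball (0::'a) \<rho>) = 0" using \<rho>(3) nf by simp
      moreover have "unit_ball_vol (real DIM('a)) \<noteq> 0" using unit_ball_vol_pos[of "real DIM('a)"] by linarith
      ultimately have "\<rho> = 0" using \<rho>(1) by (simp add: emeasure_ball)
      then have "\<not> t < g y" for y using \<rho>(2) by auto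
      moreover have "\<not> t < ?S x y" for y
        using polarizations_bounds(2)[where f=f, OF f0 fm, where ws="map x [1..<Suc n]" and x=y] t by linarith
      ultimately show ?thesis by simp
    qed simp
    show ?thesis unfolding J0 by simp
  qed
  have "(\<integral>\<^sup>+x. (\<integral>\<^sup>+y. ennreal \<bar>?S x y - g y\<bar> \<partial>lborel) \<partial>?P) = (\<integral>\<^sup>+x. (\<integral>\<^sup>+t. ?J x t \<partial>lborel) \<partial>?P)"
    unfolding J ..
  also have "\<dots> = (\<integral>\<^sup>+t. (\<integral>\<^sup>+x. ?J x t \<partial>?P) \<partial>lborel)"
    by (rule PL.Fubini'[symmetric]) measurable
  also have "\<dots> \<le> (\<integral>\<^sup>+t. ennreal (K / real n) * indicator {0<..<m} t \<partial>lborel)"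
    by (intro nn_integral_mono JP)
  also have "\<dots> = ennreal (K / real n) * ennreal m"
    using m0 by (subst nn_integral_cmult_indicator) auto
  finally show ?thesis .
qed

subsection \<open>Modulus of continuity and the supremum norm\<close>

lemma norm_sigma_refl_le_iff:
  assumes u: "norm u = 1" and r: "0 < r"
  shows "norm x \<le> norm (sigma_refl (r, u) x) \<longleftrightarrow> 2 * (u \<bullet> x) \<le> r"
proof -
  have uu: "u \<bullet> u = 1" using u by (simp add: dot_square_norm)
  have "(norm (sigma_refl (r, u) x))\<^sup>2 - (norm x)\<^sup>2 = r * (r - 2 * (u \<bullet> x))"
    unfolding sigma_refl_unit[OF u] power2_norm_eq_inner
    by (simp add: inner_add_left inner_add_right uu inner_commute algebra_simps)
  moreover have "norm x \<le> norm (sigma_refl (r, u) x) \<longleftrightarrow> 0 \<le> (norm (sigma_refl (r, u) x))\<^sup>2 - (norm x)\<^sup>2"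
    by (simp add: abs_le_square_iff[symmetric])
  ultimately show ?thesis using r by (simp add: zero_le_mult_iff)
qed

text \<open>Moving \<open>y\<close> to the side of \<open>x\<close> brings the points closer: the
  change of the squared distance is a product of two affine functions vanishing on the mirror, one
  evaluated at each point, and their signs are opposite.\<close>

lemma dist_sigma_refl_le:
  assumes u: "norm u = 1" and r: "0 < r"
    and x: "norm x \<le> norm (sigma_refl (r, u) x)" and y: "\<not> norm y \<le> norm (sigma_refl (r, u) y)"
  shows "dist x (sigma_refl (r, u) y) \<le> dist x y" "dist (sigma_refl (r, u) x) y \<le> dist x y"
proof -
  have uu: "u \<bullet> u = 1" using u by (simp add: dot_square_norm)
  have "(dist x (sigma_refl (r, u) y))\<^sup>2 - (dist x y)\<^sup>2 = (r - 2 * (u \<bullet> y)) * (r - 2 * (u \<bullet> x))"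
    unfolding sigma_refl_unit[OF u] dist_norm power2_norm_eq_inner
    by (simp add: inner_add_left inner_add_right inner_diff_left inner_diff_right uu inner_commute algebra_simps)
  also have "\<dots> \<le> 0"
    using x y unfolding norm_sigma_refl_le_iff[OF u r] by (intro mult_nonpos_nonneg) auto
  finally have "(dist x (sigma_refl (r, u) y))\<^sup>2 \<le> (dist x y)\<^sup>2" by simp
  then show "dist x (sigma_refl (r, u) y) \<le> dist x y" by (rule power2_le_imp_le) simp
  then show "dist (sigma_refl (r, u) x) y \<le> dist x y"
    using dist_sigma_refl[OF u, of r x "sigma_refl (r, u) y"] by (simp add: sigma_refl_involution[OF u])
qed

text \<open>On one side of the mirror, max is compared with max or min with min, and the direct
  pairs suffice. On opposite sides a max meets a min and the crossed pairs are needed too; they are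
  no farther apart than \<open>x\<close> and \<open>y\<close>, which is where the monotonicity of
  \<open>\<phi>\<close> enters.\<close>

lemma polarization_modulus:
  fixes f :: "'a::euclidean_space \<Rightarrow> real"
  assumes u: "norm u = 1" and r: "0 < r"
    and mono: "\<And>a b. 0 \<le> a \<Longrightarrow> a \<le> b \<Longrightarrow> \<phi> a \<le> \<phi> b"
    and f: "\<And>x y. \<bar>f x - f y\<bar> \<le> \<phi> (dist x y)"
  shows "\<bar>polarization (r, u) f x - polarization (r, u) f y\<bar> \<le> \<phi> (dist x y)"
proof -
  let ?s = "sigma_refl (r, u)"
  let ?p = "\<phi> (dist x y)"
  have 1: "\<bar>f x - f y\<bar> \<le> ?p" by (rule f)
  have 2: "\<bar>f (?s x) - f (?s y)\<bar> \<le> ?p" using f[of "?s x" "?s y"] by (simp add: dist_sigma_refl[OF u])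
  have 3: "\<bar>f x - f (?s y)\<bar> \<le> ?p" "\<bar>f (?s x) - f y\<bar> \<le> ?p"
    if "(norm x \<le> norm (?s x)) \<noteq> (norm y \<le> norm (?s y))"
  proof -
    have "dist x (?s y) \<le> dist x y \<and> dist (?s x) y \<le> dist x y"
    proof (cases "norm x \<le> norm (?s x)")
      case True
      then show ?thesis using that dist_sigma_refl_le[OF u r] by blast
    next
      case False
      then show ?thesis using that dist_sigma_refl_le[OF u r, of y x] by (simp add: dist_commute)
    qed
    then show "\<bar>f x - f (?s y)\<bar> \<le> ?p" "\<bar>f (?s x) - f y\<bar> \<le> ?p"
      using f[of x "?s y"] f[of "?s x" y] mono[of "dist x (?s y)" "dist x y"] mono[of "dist (?s x) y" "dist x y"]
      by auto
  qed
  show ?thesis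
    unfolding polarization_def using 1 2 3
    by (cases "norm x \<le> norm (?s x)"; cases "norm y \<le> norm (?s y)") (auto simp: max_def min_def)
qed

lemma polarizations_modulus:
  fixes f :: "'a::euclidean_space \<Rightarrow> real"
  assumes "admissible ws"
    and mono: "\<And>a b. 0 \<le> a \<Longrightarrow> a \<le> b \<Longrightarrow> \<phi> a \<le> \<phi> b"
    and f: "\<And>x y. \<bar>f x - f y\<bar> \<le> \<phi> (dist x y)"
  shows "\<bar>polarizations ws f x - polarizations ws f y\<bar> \<le> \<phi> (dist x y)"
  using assms(1)
proof (induction ws arbitrary: x y rule: rev_induct)
  case (snoc w ws)
  have "\<bar>polarization (fst w, snd w) (polarizations ws f) x - polarization (fst w, snd w) (polarizations ws f) y\<bar> \<le> \<phi> (dist x y)"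
    by (rule polarization_modulus[OF _ _ mono]) (use snoc in auto)
  then show ?case by simp
qed (simp add: f)

text \<open>Reflections pull null sets back to null sets. This is what allows \<open>f\<close> to be
  replaced by a Borel representative.\<close>

lemma polarizations_cong_AE:
  fixes f f' :: "'a::euclidean_space \<Rightarrow> real"
  assumes "admissible ws" and ae: "AE x in lborel. f x = f' x"
  shows "AE x in lborel. polarizations ws f x = polarizations ws f' x"
  using assms(1)
proof (induction ws rule: rev_induct)
  case (snoc w ws)
  obtain r u where w: "w = (r, u)" "norm u = 1" using snoc.prems by (cases w) auto
  have IH: "AE x in lborel. polarizations ws f x = polarizations ws f' x" using snoc by simp
  have "sigma_refl w \<in> lborel \<rightarrow>\<^sub>M borel" by measurable
  moreover have "AE x in distr lborel borel (sigma_refl w). polarizations ws f x = polarizations ws f' x"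
    using IH unfolding w(1) distr_sigma_refl[OF w(2)] .
  ultimately have "AE x in lborel. polarizations ws f (sigma_refl w x) = polarizations ws f' (sigma_refl w x)"
    by (rule AE_distrD)
  with IH show ?case
    by eventually_elim (simp add: polarization_def)
qed (simp add: ae)

text \<open>A subsequence converges almost everywhere, and the inequality passes to the limit at any
  two points of convergence. The nested form fixes a good \<open>x\<close> and leaves almost every
  \<open>y\<close>, as averaging over a ball around \<open>x\<close> requires.\<close>

lemma AE_modulus_of_L1_limit:
  fixes h :: "nat \<Rightarrow> 'a::euclidean_space \<Rightarrow> real"
  assumes h [measurable]: "\<And>k. h k \<in> borel_measurable borel" and g [measurable]: "g \<in> borel_measurable borel"
    and mod: "\<And>k x y. \<bar>h k x - h k y\<bar> \<le> \<phi> (dist x y)"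
    and lim: "\<And>k. (\<integral>\<^sup>+y. ennreal \<bar>h k y - g y\<bar> \<partial>lborel) \<le> ennreal (e k)" and e: "e \<longlonglongrightarrow> 0" and e0: "\<And>k. 0 \<le> e k"
  shows "AE x in lborel. AE y in lborel. \<bar>g x - g y\<bar> \<le> \<phi> (dist x y)"
proof -
  have int: "integrable lborel (\<lambda>y. h k y - g y)" for k
    using order.strict_trans1[OF lim[of k]] by (intro integrableI_bounded) auto
  have le: "(\<integral>y. norm (h k y - g y) \<partial>lborel) \<le> e k" for k
  proof -
    have "ennreal (\<integral>y. norm (h k y - g y) \<partial>lborel) = (\<integral>\<^sup>+y. ennreal (norm (h k y - g y)) \<partial>lborel)"
      using int by (intro nn_integral_eq_integral[symmetric]) auto
    also have "\<dots> \<le> ennreal (e k)" using lim[of k] by simp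
    finally show ?thesis using e0[of k] by (simp add: ennreal_le_iff)
  qed
  have "(\<lambda>k. \<integral>y. norm (h k y - g y) \<partial>lborel) \<longlonglongrightarrow> 0"
    by (rule tendsto_sandwich[OF always_eventually always_eventually tendsto_const e]) (simp, intro allI le)
  from tendsto_L1_AE_subseq[OF int this] obtain s where
    s: "AE x in lborel. (\<lambda>k. h (s k) x - g x) \<longlonglongrightarrow> 0" by blast
  have lim: "\<bar>g x - g y\<bar> \<le> \<phi> (dist x y)"
    if "(\<lambda>k. h (s k) x - g x) \<longlonglongrightarrow> 0" "(\<lambda>k. h (s k) y - g y) \<longlonglongrightarrow> 0" for x y
  proof -
    have "(\<lambda>k. h (s k) x) \<longlonglongrightarrow> g x" "(\<lambda>k. h (s k) y) \<longlonglongrightarrow> g y"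
      using that by (simp_all add: LIM_zero_cancel)
    then have "(\<lambda>k. \<bar>h (s k) x - h (s k) y\<bar>) \<longlonglongrightarrow> \<bar>g x - g y\<bar>"
      by (intro tendsto_intros)
    then show ?thesis by (rule LIMSEQ_le_const2) (auto simp: mod)
  qed
  show ?thesis
    using s
  proof eventually_elim
    case (elim x)
    show ?case using s by eventually_elim (rule lim[OF elim])
  qed
qed

lemma Linf_norm_diff_le:
  fixes g h :: "'a::euclidean_space \<Rightarrow> real"
  assumes [measurable]: "h \<in> borel_measurable borel" "g \<in> borel_measurable borel"
    and mono: "\<And>a b. 0 \<le> a \<Longrightarrow> a \<le> b \<Longrightarrow> \<phi> a \<le> \<phi> b"
    and h: "\<And>x y. \<bar>h x - h y\<bar> \<le> \<phi> (dist x y)"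
    and g: "AE x in lborel. AE y in lborel. \<bar>g x - g y\<bar> \<le> \<phi> (dist x y)"
    and \<delta>: "0 < \<delta>"
  defines "v \<equiv> unit_ball_vol (real DIM('a)) * \<delta> ^ DIM('a)"
  shows "Linf_norm (\<lambda>x. h x - g x) \<le> ennreal (2 * \<phi> \<delta>) + ennreal (1 / v) * (\<integral>\<^sup>+y. ennreal \<bar>h y - g y\<bar> \<partial>lborel)"
  unfolding Linf_norm_def
proof (rule esssup_I)
  show "(\<lambda>x. ennreal \<bar>h x - g x\<bar>) \<in> borel_measurable lebesgue" by (intro measurable_completion) measurable
  let ?I = "\<integral>\<^sup>+y. ennreal \<bar>h y - g y\<bar> \<partial>lborel"
  have v: "0 < v" using \<delta> by (simp add: v_def)
  have "AE x in lborel. ennreal \<bar>h x - g x\<bar> \<le> ennreal (2 * \<phi> \<delta>) + ennreal (1 / v) * ?I"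
    using g
  proof eventually_elim
    case (elim x)
    \<comment> \<open>The excess at \<open>x\<close> may be negative; then \<open>ennreal b\<close>
      is \<open>0\<close> and the volume estimate is trivial.\<close>
    define b where "b = \<bar>h x - g x\<bar> - 2 * \<phi> \<delta>"
    have "0 \<le> \<phi> 0" using h[of x x] by simp
    then have p0: "0 \<le> \<phi> \<delta>" using mono[of 0 \<delta>] \<delta> by linarith
    have "ennreal b * ennreal v = (\<integral>\<^sup>+y. ennreal b * indicator (ball x \<delta>) y \<partial>lborel)"
      using \<delta> by (subst nn_integral_cmult_indicator) (simp_all add: emeasure_ball v_def)
    also have "\<dots> \<le> ?I"
    proof (rule nn_integral_mono_AE)
      show "AE y in lborel. ennreal b * indicator (ball x \<delta>) y \<le> ennreal \<bar>h y - g y\<bar>"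
        using elim
      proof eventually_elim
        case (elim y)
        show ?case
        proof (cases "y \<in> ball x \<delta>")
          case True
          then have "\<phi> (dist x y) \<le> \<phi> \<delta>" by (intro mono) auto
          \<comment> \<open>Passing from \<open>x\<close> to \<open>y\<close> costs at most
            \<open>\<phi> \<delta>\<close> for \<open>h\<close> and again for
            \<open>g\<close>.\<close>
          then have "b \<le> \<bar>h y - g y\<bar>" using elim h[of x y] unfolding b_def by linarith
          then show ?thesis using True by (simp add: ennreal_leI)
        qed simp
      qed
    qed
    finally have bI: "ennreal b * ennreal v \<le> ?I" .
    have "ennreal b = ennreal (1 / v) * (ennreal b * ennreal v)"
    proof -
      have "ennreal (1 / v) * ennreal v = 1" using v by (simp add: ennreal_mult[symmetric])
      then show ?thesis by (metis mult.left_commute mult_1_right)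
    qed
    also have "\<dots> \<le> ennreal (1 / v) * ?I" using bI by (rule mult_left_mono) simp
    finally have "ennreal b \<le> ennreal (1 / v) * ?I" .
    moreover have "ennreal \<bar>h x - g x\<bar> \<le> ennreal (2 * \<phi> \<delta>) + ennreal b"
    proof (cases "0 \<le> b")
      case True
      then show ?thesis using p0 by (simp add: ennreal_plus[symmetric] b_def del: ennreal_plus)
    next
      case False
      then have "ennreal \<bar>h x - g x\<bar> \<le> ennreal (2 * \<phi> \<delta>)" by (intro ennreal_leI) (simp add: b_def)
      then show ?thesis by (rule order_trans) simp
    qed
    ultimately show ?case by (meson add_left_mono order_trans)
  qed
  then show "AE x in lebesgue. ennreal \<bar>h x - g x\<bar> \<le> ennreal (2 * \<phi> \<delta>) + ennreal (1 / v) * ?I"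
    by (rule AE_completion)
qed

text \<open>An essential supremum exceeds \<open>s\<close> exactly if the set of points with values
  above \<open>s\<close> has positive measure, and that measure depends measurably on the parameter
  by Fubini.\<close>

lemma borel_measurable_esssup_lebesgue:
  fixes H :: "'b \<Rightarrow> 'a::euclidean_space \<Rightarrow> ennreal"
  assumes H: "(\<lambda>p. H (fst p) (snd p)) \<in> borel_measurable (N \<Otimes>\<^sub>M lborel)"
  shows "(\<lambda>z. esssup lebesgue (H z)) \<in> borel_measurable N"
proof (rule borel_measurableI_greater)
  fix s :: ennreal
  note [measurable] = H
  let ?F = "\<lambda>z. \<integral>\<^sup>+y. of_bool (s < H z y) \<partial>lborel"
  have [measurable]: "?F \<in> borel_measurable N" by measurable
  have "s < esssup lebesgue (H z) \<longleftrightarrow> ?F z \<noteq> 0" if z: "z \<in> space N" for z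
  proof -
    have [measurable]: "H z \<in> borel_measurable lborel"
      using measurable_compose[OF measurable_Pair1'[OF z] H] by simp
    then have Hl: "H z \<in> borel_measurable lebesgue" by (rule measurable_completion)
    have "esssup lebesgue (H z) \<le> s \<longleftrightarrow> (AE y in lebesgue. H z y \<le> s)"
    proof
      assume "esssup lebesgue (H z) \<le> s"
      with esssup_AE[of "H z" lebesgue] show "AE y in lebesgue. H z y \<le> s"
        by (auto elim!: eventually_mono)
    qed (rule esssup_I[OF Hl])
    also have "\<dots> \<longleftrightarrow> (AE y in lborel. H z y \<le> s)" by (rule AE_completion_iff)
    also have "\<dots> \<longleftrightarrow> ?F z = 0" by (subst nn_integral_0_iff_AE) (auto simp: not_less)
    finally show ?thesis by (simp add: not_le[symmetric])
  qed
  then have "{z \<in> space N. s < esssup lebesgue (H z)} = {z \<in> space N. ?F z \<noteq> 0}" by auto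
  also have "\<dots> \<in> sets N" by measurable
  finally show "{z \<in> space N. s < esssup lebesgue (H z)} \<in> sets N" .
qed

text \<open>The probabilistic method: if every sequence of reflections stayed farther from
  \<open>g\<close> than \<open>e k\<close>, so would the mean. Hence deterministic polarizations of
  \<open>f\<close>, all with modulus \<open>\<phi>\<close>, converge to \<open>g\<close> in
  L^1.\<close>

lemma AE_modulus_symm_decr_rearrangement:
  fixes f :: "'a::euclidean_space \<Rightarrow> real"
  assumes L: "0 < L" and f: "f \<in> borel_measurable borel"
    and f0: "\<And>x. 0 \<le> f x" and fm: "\<And>x. f x \<le> m"
    and supp: "\<And>x. f x \<noteq> 0 \<Longrightarrow> norm x \<le> L"
    and g: "is_symm_decr_rearrangement f g"
    and mono: "\<And>a b. 0 \<le> a \<Longrightarrow> a \<le> b \<Longrightarrow> \<phi> a \<le> \<phi> b"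
    and mod: "\<And>x y. \<bar>f x - f y\<bar> \<le> \<phi> (dist x y)"
  shows "AE x in lborel. AE y in lborel. \<bar>g x - g y\<bar> \<le> \<phi> (dist x y)"
proof -
  let ?U = "uniform_reflection L :: (real \<times> 'a) measure"
  interpret U: prob_space ?U by (rule prob_space_uniform_reflection[OF L])
  define K where "K = 2 * (real DIM('a) * unit_ball_vol (real DIM('a)) * (2 * L) ^ DIM('a))"
  \<comment> \<open>With \<open>m + 1\<close> in place of \<open>m\<close>, \<open>e k\<close> stays
    strictly above the expected distance even for \<open>m = 0\<close>; integrating the negated
    claim yields only a weak inequality.\<close>
  define e where "e k = 2 * (m + 1) * K / real (Suc k)" for k
  have K: "0 < K" using L by (simp add: K_def)
  have m: "0 \<le> m" using f0 fm order_trans by blast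
  have "\<exists>ws. admissible ws \<and> (\<integral>\<^sup>+y. ennreal \<bar>polarizations ws f y - g y\<bar> \<partial>lborel) \<le> ennreal (e k)" for k
  proof (rule ccontr)
    assume *: "\<not> ?thesis"
    let ?P = "\<Pi>\<^sub>M i\<in>{1..Suc k}. ?U"
    interpret P: prob_space ?P by (rule prob_space_PiM) (rule U.prob_space_axioms)
    have "ennreal (e k) = (\<integral>\<^sup>+x. ennreal (e k) \<partial>?P)"
      by (simp only: nn_integral_const P.emeasure_space_1 mult_1_right)
    also have "\<dots> \<le> (\<integral>\<^sup>+x. (\<integral>\<^sup>+y. ennreal \<bar>polarizations (map x [1..<Suc (Suc k)]) f y - g y\<bar> \<partial>lborel) \<partial>?P)"
    proof (rule nn_integral_mono)
      fix x assume "x \<in> space ?P"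
      then have "\<not> (\<integral>\<^sup>+y. ennreal \<bar>polarizations (map x [1..<Suc (Suc k)]) f y - g y\<bar> \<partial>lborel) \<le> ennreal (e k)"
        using * admissible_PiM by blast
      then show "ennreal (e k) \<le> (\<integral>\<^sup>+y. ennreal \<bar>polarizations (map x [1..<Suc (Suc k)]) f y - g y\<bar> \<partial>lborel)"
        by (simp only: not_le less_imp_le)
    qed
    also have "\<dots> \<le> ennreal (K / real (Suc k)) * ennreal m"
      unfolding K_def by (rule expected_L1_distance_le[OF L f f0 fm supp g]) simp_all
    also have "\<dots> = ennreal (K / real (Suc k) * m)"
      using K m by (intro ennreal_mult[symmetric]) auto
    finally have "e k \<le> K / real (Suc k) * m"
      using K m by (subst (asm) ennreal_le_iff) auto
    moreover have "K / real (Suc k) * m < e k"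
    proof -
      have "0 \<le> K * m" using K m by simp
      then have "K * m < 2 * (m + 1) * K" using K by (simp add: algebra_simps)
      then show ?thesis unfolding e_def using divide_strict_right_mono[of "K * m" "2 * (m + 1) * K" "real (Suc k)"] by simp
    qed
    ultimately show False by simp
  qed
  then obtain ws where ws: "\<And>k. admissible (ws k)"
      "\<And>k. (\<integral>\<^sup>+y. ennreal \<bar>polarizations (ws k) f y - g y\<bar> \<partial>lborel) \<le> ennreal (e k)"
    by metis
  show ?thesis
  proof (rule AE_modulus_of_L1_limit[OF _ _ _ ws(2)])
    show "polarizations (ws k) f \<in> borel_measurable borel" for k
      by (rule borel_measurable_polarizations[OF f])
    show "g \<in> borel_measurable borel"
      using g by (intro borel_measurable_lower_semicontinuous) (simp add: is_symm_decr_rearrangement_def)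
    show "\<bar>polarizations (ws k) f x - polarizations (ws k) f y\<bar> \<le> \<phi> (dist x y)" for k x y
      by (rule polarizations_modulus[where f=f and \<phi>=\<phi>, OF ws(1) mono mod])
    show "e \<longlonglongrightarrow> 0"
      unfolding e_def by (rule LIMSEQ_Suc[OF lim_const_over_n])
    show "0 \<le> e k" for k using K m by (simp add: e_def)
  qed
qed

text \<open>The power of \<open>n\<close> in \<open>\<delta>\<close> balances the two terms: with
  \<open>s = n powr (- 1 / (d + \<alpha>))\<close>, both \<open>s powr \<alpha>\<close> and
  \<open>1 / (n s^d)\<close> equal the claimed rate. The constant is \<open>8 + 2\<close>: the first
  term contributes \<open>2 * 4 powr \<alpha> \<le> 8\<close>, the second
  \<open>(2 d / 2^d) * 2 powr \<alpha> \<le> 2\<close>.\<close>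

lemma holder_rate:
  fixes L c \<alpha> \<kappa> :: real and n d :: nat
  assumes L: "0 < L" and c: "0 < c" and \<alpha>: "0 < \<alpha>" "\<alpha> \<le> 1" and n: "1 \<le> n" and \<kappa>: "0 < \<kappa>"
  defines "\<delta> \<equiv> 4 * L * real n powr (- (1 / (real d + \<alpha>)))"
  defines "K \<equiv> 2 * (real d * \<kappa> * (2 * L) ^ d)"
  shows "2 * (c * \<delta> powr \<alpha>) + 1 / (\<kappa> * \<delta> ^ d) * (K / real n * (c * (2 * L) powr \<alpha>)) \<le>
    10 * c * L powr \<alpha> * real n powr (- (\<alpha> / (real d + \<alpha>)))"
proof -
  define N where "N = real n"
  have N: "0 < N" using n by (simp add: N_def)
  define s where "s = N powr (- (1 / (real d + \<alpha>)))"
  define q where "q = N powr (- (\<alpha> / (real d + \<alpha>)))"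
  have s: "0 < s" using N by (simp add: s_def)
  have q: "0 < q" using N by (simp add: q_def)
  have da: "0 < real d + \<alpha>" using \<alpha> by (simp add: add_nonneg_pos)
  have sa: "s powr \<alpha> = q" by (simp add: s_def q_def powr_powr)
  have "N * s ^ d = N powr (1 + (- (1 / (real d + \<alpha>))) * real d)"
    using N s by (simp add: s_def powr_realpow[symmetric] powr_powr powr_mult_base)
  also have "1 + (- (1 / (real d + \<alpha>))) * real d = \<alpha> / (real d + \<alpha>)"
    using da by (simp add: field_simps)
  finally have "N * s ^ d * q = 1" using N by (simp add: q_def powr_minus)
  then have sd: "1 / (N * s ^ d) = q" using N s by (simp add: field_simps)
  have \<delta>: "\<delta> = 4 * L * s" by (simp add: \<delta>_def s_def N_def)
  have p4: "4 powr \<alpha> \<le> (4::real)" and p2: "2 powr \<alpha> \<le> (2::real)"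
    using \<alpha> powr_mono[of \<alpha> 1 4] powr_mono[of \<alpha> 1 2] by auto
  have "\<delta> powr \<alpha> = 4 powr \<alpha> * (L powr \<alpha> * q)"
    using L s by (simp add: \<delta> powr_mult sa)
  also have "\<dots> \<le> 4 * (L powr \<alpha> * q)" using p4 q by (intro mult_right_mono) auto
  finally have "2 * (c * \<delta> powr \<alpha>) \<le> 2 * (c * (4 * (L powr \<alpha> * q)))"
    using c by (intro mult_left_mono) auto
  moreover have "1 / (\<kappa> * \<delta> ^ d) * (K / N * (c * (2 * L) powr \<alpha>)) \<le> 2 * (c * (L powr \<alpha> * q))"
  proof -
    define A where "A = (2 * L) ^ d"
    have A: "0 < A" using L by (simp add: A_def)
    have "4 * L * s = 2 * (2 * L) * s" by simp
    then have dd: "\<delta> ^ d = 2 ^ d * A * s ^ d" unfolding \<delta> A_def by (simp only: power_mult_distrib)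
    have "1 / (\<kappa> * (p * A * t)) * (2 * (real d * \<kappa> * A) / N * z) = 2 * real d / p * (1 / (N * t)) * z"
      if "0 < p" "0 < t" for p t z :: real
      using that A \<kappa> N by (simp add: field_simps)
    from this[of "2 ^ d" "s ^ d"] have "1 / (\<kappa> * \<delta> ^ d) * (K / N * (c * (2 * L) powr \<alpha>)) =
        2 * real d / 2 ^ d * (1 / (N * s ^ d)) * (c * (2 * L) powr \<alpha>)"
      unfolding dd K_def A_def[symmetric] using s by simp
    also have "\<dots> = 2 * real d / 2 ^ d * (q * (c * (2 * L) powr \<alpha>))"
      unfolding sd by simp
    also have "\<dots> \<le> 1 * (q * (c * (2 * L) powr \<alpha>))"
    proof (rule mult_right_mono)
      \<comment> \<open>The factor 4 in \<open>\<delta>\<close> makes \<open>\<delta>\<close> equal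
        to \<open>2 * (2 L) * s\<close>; the resulting \<open>2 ^ d\<close> in the denominator
        absorbs the \<open>2 d\<close> of \<open>K\<close>.\<close>
      have "2 * real d \<le> 2 ^ d"
      proof (cases d)
        case (Suc k)
        have "Suc k \<le> 2 ^ k" by (rule Suc_leI[OF less_exp])
        then have "real (Suc k) \<le> 2 ^ k" by (metis of_nat_le_iff of_nat_numeral of_nat_power)
        then show ?thesis unfolding Suc by simp
      qed simp
      then show "2 * real d / 2 ^ d \<le> 1" by simp
      show "0 \<le> q * (c * (2 * L) powr \<alpha>)" using q c by simp
    qed
    also have "\<dots> \<le> 1 * (q * (c * (2 * L powr \<alpha>)))"
      using p2 q c L by (intro mult_left_mono) (auto simp: powr_mult intro!: mult_right_mono)
    finally show ?thesis by (simp add: mult_ac)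
  qed
  ultimately show ?thesis unfolding N_def[symmetric] q_def[symmetric] by (simp add: mult_ac)
qed

section \<open>Reduction to the product space and to Borel functions\<close>

lemma L1_norm_cong_AE:
  assumes "AE x in lborel. f x = g x"
  shows "L1_norm f = (\<integral>\<^sup>+x. ennreal \<bar>g x\<bar> \<partial>lborel)"
  unfolding L1_norm_def nn_integral_completion
  using assms by (intro nn_integral_cong_AE) (auto elim!: eventually_mono)

text \<open>Independence and the common law say that the first \<open>n\<close> reflections, taken
  as one random variable, have the product law on which the recursion runs.\<close>

lemma nn_integral_indep_uniform_reflections:
  fixes W :: "nat \<Rightarrow> 'w \<Rightarrow> real \<times> 'a::euclidean_space"
  assumes M: "prob_space M"
    and indep: "prob_space.indep_vars M (\<lambda>_. uniform_reflection L) W {1..}"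
    and unif: "\<And>i. 1 \<le> i \<Longrightarrow> distr M (uniform_reflection L) (W i) = uniform_reflection L"
    and n: "1 \<le> n"
    and F: "F \<in> borel_measurable (\<Pi>\<^sub>M i\<in>{1..n}. uniform_reflection L)"
  shows "(\<integral>\<^sup>+\<omega>. F (\<lambda>i\<in>{1..n}. W i \<omega>) \<partial>M) = (\<integral>\<^sup>+x. F x \<partial>(\<Pi>\<^sub>M i\<in>{1..n}. uniform_reflection L))"
proof -
  let ?U = "uniform_reflection L :: (real \<times> 'a) measure"
  let ?X = "\<lambda>\<omega>. \<lambda>i\<in>{1..n}. W i \<omega>"
  interpret prob_space M by fact
  have rv: "random_variable ?U (W i)" if "i \<in> {1..n}" for i
    using indep that by (auto simp: indep_vars_def2)
  have ind: "indep_vars (\<lambda>_. ?U) W {1..n}"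
    by (rule indep_vars_subset[OF indep]) auto
  have "distr M (\<Pi>\<^sub>M i\<in>{1..n}. ?U) ?X = (\<Pi>\<^sub>M i\<in>{1..n}. distr M ?U (W i))"
    using ind n by (subst indep_vars_iff_distr_eq_PiM'[symmetric]) (auto intro: rv)
  also have "\<dots> = (\<Pi>\<^sub>M i\<in>{1..n}. ?U)"
    by (rule PiM_cong) (auto simp: unif)
  finally have "(\<integral>\<^sup>+x. F x \<partial>(\<Pi>\<^sub>M i\<in>{1..n}. ?U)) = (\<integral>\<^sup>+x. F x \<partial>distr M (\<Pi>\<^sub>M i\<in>{1..n}. ?U) ?X)" by simp
  also have "\<dots> = (\<integral>\<^sup>+\<omega>. F (?X \<omega>) \<partial>M)"
    using F rv by (intro nn_integral_distr measurable_restrict) auto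
  finally show ?thesis ..
qed

lemma holder_borel_measurable:
  fixes f :: "'a::euclidean_space \<Rightarrow> real"
  assumes \<alpha>: "0 < \<alpha>" and f: "\<And>x y. \<bar>f x - f y\<bar> \<le> c * dist x y powr \<alpha>"
  shows "f \<in> borel_measurable borel"
proof (rule borel_measurable_continuous_onI)
  show "continuous_on UNIV f"
    unfolding continuous_on_def
  proof
    fix x :: 'a
    have "((\<lambda>y. dist y x powr \<alpha>) \<longlongrightarrow> dist x x powr \<alpha>) (at x)"
      using \<alpha> by (intro tendsto_powr' tendsto_intros) auto
    then have "((\<lambda>y. c * dist y x powr \<alpha>) \<longlongrightarrow> 0) (at x)"
      using \<alpha> by (auto intro: tendsto_mult_right_zero)
    then have "((\<lambda>y. f y - f x) \<longlongrightarrow> 0) (at x)"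
      by (rule Lim_null_comparison[rotated]) (auto simp: f)
    then show "(f \<longlongrightarrow> f x) (at x)" by (rule LIM_zero_cancel)
  qed
qed

text \<open>Each point of the ball lies within \<open>2 L\<close> of a zero of \<open>f\<close>,
  namely the point of norm \<open>2 L\<close> on the same ray; at the origin any unit vector gives a
  ray.\<close>

lemma holder_bound:
  fixes f :: "'a::euclidean_space \<Rightarrow> real"
  assumes L: "0 < L" and \<alpha>: "0 < \<alpha>" and c: "0 < c"
    and f: "\<And>x y. \<bar>f x - f y\<bar> \<le> c * dist x y powr \<alpha>"
    and supp: "\<And>x. f x \<noteq> 0 \<Longrightarrow> norm x \<le> L"
  shows "f x \<le> c * (2 * L) powr \<alpha>"
proof (cases "norm x \<le> L")
  case True
  obtain u where u: "norm u = 1" "x = norm x *\<^sub>R u"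
  proof (cases "x = 0")
    case True
    obtain b :: 'a where "b \<in> Basis" using nonempty_Basis by blast
    then show ?thesis using that[of b] True by simp
  next
    case False
    then show ?thesis using that[of "x /\<^sub>R norm x"] by simp
  qed
  define y where "y = (2 * L) *\<^sub>R u"
  have "norm y = 2 * L" using u L by (simp add: y_def)
  then have fy: "f y = 0" using supp[of y] L by fastforce
  have "dist x y = norm ((norm x - 2 * L) *\<^sub>R u)"
    unfolding dist_norm y_def by (subst u(2)) (simp add: scaleR_diff_left)
  also have "\<dots> \<le> 2 * L" using True u L by simp
  finally have "c * dist x y powr \<alpha> \<le> c * (2 * L) powr \<alpha>"
    using c \<alpha> by (intro mult_left_mono powr_mono2) auto
  then show ?thesis using f[of x y] fy by simp
next
  case False
  then have "f x = 0" using supp by blast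
  then show ?thesis using c by simp
qed

lemma is_symm_decr_rearrangement_cong:
  assumes "is_symm_decr_rearrangement f g"
    and "\<And>t. 0 < t \<Longrightarrow> emeasure lebesgue {x. t < f x} = emeasure lebesgue {x. t < f' x}"
  shows "is_symm_decr_rearrangement f' g"
  using assms by (simp add: is_symm_decr_rearrangement_def symm_set_def)

text \<open>A Lebesgue measurable function composed with a measurable map need not be measurable,
  whereas a Borel function causes no trouble when the reflection varies. The pointwise bound is the
  essential supremum itself, so that the final estimate contains \<open>Linf_norm f\<close>.\<close>

lemma bounded_borel_representative:
  fixes f :: "'a::euclidean_space \<Rightarrow> real"
  assumes f_meas: "f \<in> borel_measurable lebesgue" and f0: "\<And>x. 0 \<le> f x"
    and f_bdd: "bounded (range f)" and supp: "\<And>x. f x \<noteq> 0 \<Longrightarrow> norm x \<le> L"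
  obtains f' m where "f' \<in> borel_measurable borel" "AE x in lborel. f x = f' x" "\<And>x. 0 \<le> f' x" "\<And>x. f' x \<le> m"
    "\<And>x. f' x \<noteq> 0 \<Longrightarrow> norm x \<le> L" "Linf_norm f = ennreal m"
proof -
  obtain b where b: "\<And>x. norm (f x) \<le> b" using f_bdd by (auto simp: bounded_iff)
  have "Linf_norm f \<le> ennreal b"
    unfolding Linf_norm_def using f_meas b
    by (intro esssup_I measurable_compose[OF _ measurable_ennreal]) (auto intro!: ennreal_leI)
  then have "Linf_norm f \<noteq> top" by (auto simp: top_unique)
  then obtain m where m: "0 \<le> m" "Linf_norm f = ennreal m" by (metis ennreal_cases)
  obtain h where [measurable]: "h \<in> borel_measurable lborel" and h: "AE x in lborel. f x = h x"
    using completion_ex_borel_measurable_real[OF f_meas] by auto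
  have "AE x in lebesgue. ennreal \<bar>f x\<bar> \<le> ennreal m"
    using esssup_AE[of "\<lambda>x. ennreal \<bar>f x\<bar>" lebesgue] m(2) by (simp add: Linf_norm_def)
  then have fm: "AE x in lborel. f x \<le> m"
    using m(1) f0 by (simp add: AE_completion_iff)
  \<comment> \<open>The truncations restore at every point what equality almost everywhere gives
    only up to a null set: sign, bound and support.\<close>
  define f' where "f' x = (if norm x \<le> L then min m (max 0 (h x)) else 0)" for x
  show ?thesis
  proof (rule that[of f' m])
    show "f' \<in> borel_measurable borel" unfolding f'_def by measurable
    show "AE x in lborel. f x = f' x"
      using h fm
    proof eventually_elim
      case (elim x)
      then show ?case using f0[of x] supp[of x] by (auto simp: f'_def)
    qed
  qed (use m in \<open>auto simp: f'_def split: if_splits\<close>)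
qed

subsection \<open>The rates of convergence\<close>

theorem proposition5p2:
  fixes M :: "'w measure" and W :: "nat \<Rightarrow> 'w \<Rightarrow> real \<times> 'a::euclidean_space"
    and L :: real and n :: nat and f :: "'a \<Rightarrow> real"
  assumes L: "0 < L"
    and M: "prob_space M"
    and indep: "prob_space.indep_vars M (\<lambda>_. uniform_reflection L) W {1..}"
    and unif: "\<And>i. 1 \<le> i \<Longrightarrow> distr M (uniform_reflection L) (W i) = uniform_reflection L"
    and n: "1 \<le> n"
    and f_meas: "f \<in> borel_measurable lebesgue"
    and f_nonneg: "\<And>x. 0 \<le> f x"
    and f_bdd: "bounded (range f)"
    and f_supp: "closure {x. f x \<noteq> 0} \<subseteq> cball 0 L"
  shows "((\<lambda>\<omega>. L1_norm (\<lambda>x. polarizations (map (\<lambda>i. W i \<omega>) [1..<Suc n]) f x - symm_decr_rearrangement f x)) \<in> borel_measurable M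
      \<and> (\<integral>\<^sup>+ \<omega>. L1_norm (\<lambda>x. polarizations (map (\<lambda>i. W i \<omega>) [1..<Suc n]) f x - symm_decr_rearrangement f x) \<partial>M)
          \<le> 2 * of_nat DIM('a) * emeasure lebesgue (ball (0::'a) (2 * L)) * Linf_norm f / of_nat n)
    \<and> (\<forall>c \<alpha>. 0 < c \<and> 0 < \<alpha> \<and> \<alpha> \<le> 1 \<and>
          (\<forall>\<delta>>0. modulus_of_continuity f \<delta> \<le> ennreal (c * \<delta> powr \<alpha>)) \<longrightarrow>
        (\<lambda>\<omega>. Linf_norm (\<lambda>x. polarizations (map (\<lambda>i. W i \<omega>) [1..<Suc n]) f x - symm_decr_rearrangement f x)) \<in> borel_measurable M
        \<and> (\<integral>\<^sup>+ \<omega>. Linf_norm (\<lambda>x. polarizations (map (\<lambda>i. W i \<omega>) [1..<Suc n]) f x - symm_decr_rearrangement f x) \<partial>M)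
            \<le> ennreal (10 * c * L powr \<alpha> * real n powr (- (\<alpha> / (real DIM('a) + \<alpha>)))))"
proof -
  let ?U = "uniform_reflection L :: (real \<times> 'a) measure"
  let ?P = "\<Pi>\<^sub>M i\<in>{1..n}. ?U"
  let ?X = "\<lambda>\<omega>. \<lambda>i\<in>{1..n}. W i \<omega>"
  let ?S = "\<lambda>x. polarizations (map x [1..<Suc n])"
  let ?g = "symm_decr_rearrangement f"
  define K where "K = 2 * (real DIM('a) * unit_ball_vol (real DIM('a)) * (2 * L) ^ DIM('a))"
  have K: "0 < K" using L by (simp add: K_def)
  interpret M: prob_space M by (rule M)
  have supp: "norm x \<le> L" if "f x \<noteq> 0" for x
    using f_supp closure_subset[of "{x. f x \<noteq> 0}"] that by force
  have X: "?X \<in> M \<rightarrow>\<^sub>M ?P"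
    using indep by (intro measurable_restrict) (auto simp: M.indep_vars_def2)
  \<comment> \<open>Outside \<open>{1..n}\<close> the restricted family is \<open>undefined\<close>,
    but the list only reads the indices \<open>1\<close> to \<open>n\<close>.\<close>
  have WX: "map (\<lambda>i. W i \<omega>) [1..<Suc n] = map (?X \<omega>) [1..<Suc n]" for \<omega>
    by (intro map_cong) auto
  have adX: "admissible (map (?X \<omega>) [1..<Suc n])" if "\<omega> \<in> space M" for \<omega>
    by (rule admissible_PiM[OF measurable_space[OF X that]])
  obtain b where "\<And>x. norm (f x) \<le> b" using f_bdd by (auto simp: bounded_iff)
  then have "\<And>x. f x \<le> b" by (metis abs_ge_self order_trans real_norm_def)
  then have g: "is_symm_decr_rearrangement f ?g"
    using emeasure_superlevel_finite[of f L, OF supp] by (intro symm_decr_rearrangement[OF f_meas]) auto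
  have gm [measurable]: "?g \<in> borel_measurable borel"
    using g by (intro borel_measurable_lower_semicontinuous) (simp add: is_symm_decr_rearrangement_def)
  have L1m: "(\<lambda>x. \<integral>\<^sup>+y. ennreal \<bar>?S x h y - ?g y\<bar> \<partial>lborel) \<in> borel_measurable ?P"
    if h: "h \<in> borel_measurable borel" for h :: "'a \<Rightarrow> real"
  proof -
    have [measurable]: "(\<lambda>p. ?S (fst p) h (snd p)) \<in> borel_measurable (?P \<Otimes>\<^sub>M lborel)"
      by (rule measurable_polarizations_PiM[OF h]) auto
    show ?thesis by measurable
  qed
  have part1: "(\<lambda>\<omega>. L1_norm (\<lambda>x. ?S (?X \<omega>) f x - ?g x)) \<in> borel_measurable M \<and>
      (\<integral>\<^sup>+ \<omega>. L1_norm (\<lambda>x. ?S (?X \<omega>) f x - ?g x) \<partial>M)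
          \<le> 2 * of_nat DIM('a) * emeasure lebesgue (ball (0::'a) (2 * L)) * Linf_norm f / of_nat n"
  proof -
    obtain f' m where f': "f' \<in> borel_measurable borel" "AE x in lborel. f x = f' x" "\<And>x. 0 \<le> f' x" "\<And>x. f' x \<le> m"
      "\<And>x. f' x \<noteq> 0 \<Longrightarrow> norm x \<le> L" "Linf_norm f = ennreal m"
      by (rule bounded_borel_representative[OF f_meas f_nonneg f_bdd supp]) (assumption, rule that)
    have g': "is_symm_decr_rearrangement f' ?g"
    proof (rule is_symm_decr_rearrangement_cong[OF g])
      fix t :: real
      have "{x. t < f x} \<in> sets lebesgue" using borel_measurable_less[of "\<lambda>_. t" lebesgue f] f_meas by simp
      moreover have "{x. t < f' x} \<in> sets lebesgue"
        using borel_measurable_less[of "\<lambda>_. t" borel f'] f'(1) by simp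
      ultimately show "emeasure lebesgue {x. t < f x} = emeasure lebesgue {x. t < f' x}"
        using AE_completion[OF f'(2)] by (intro emeasure_eq_AE) (auto elim!: eventually_mono)
    qed
    let ?F = "\<lambda>x. \<integral>\<^sup>+y. ennreal \<bar>?S x f' y - ?g y\<bar> \<partial>lborel"
    \<comment> \<open>Finitely many reflections keep the exceptional null set null, so the equality
      holds for every outcome and not merely almost surely.\<close>
    have eq: "L1_norm (\<lambda>x. ?S (?X \<omega>) f x - ?g x) = ?F (?X \<omega>)" if "\<omega> \<in> space M" for \<omega>
      using polarizations_cong_AE[OF adX[OF that] f'(2)]
      by (intro L1_norm_cong_AE) (auto elim!: eventually_mono)
    have "(\<lambda>\<omega>. ?F (?X \<omega>)) \<in> borel_measurable M"
      by (rule measurable_compose[OF X L1m[OF f'(1)]])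
    moreover have "(\<integral>\<^sup>+ \<omega>. L1_norm (\<lambda>x. ?S (?X \<omega>) f x - ?g x) \<partial>M) \<le>
        2 * of_nat DIM('a) * emeasure lebesgue (ball (0::'a) (2 * L)) * Linf_norm f / of_nat n"
    proof -
      have "(\<integral>\<^sup>+ \<omega>. L1_norm (\<lambda>x. ?S (?X \<omega>) f x - ?g x) \<partial>M) = (\<integral>\<^sup>+ \<omega>. ?F (?X \<omega>) \<partial>M)"
        by (rule nn_integral_cong) (rule eq)
      also have "\<dots> = (\<integral>\<^sup>+x. ?F x \<partial>?P)"
        by (rule nn_integral_indep_uniform_reflections[OF M indep unif n L1m[OF f'(1)]])
      also have "\<dots> \<le> ennreal (K / real n) * ennreal m"
        unfolding K_def by (rule expected_L1_distance_le[OF L f'(1,3,4,5) g' n])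
      also have "\<dots> = ennreal K * Linf_norm f / of_nat n"
        using K n by (simp add: f'(6) divide_ennreal[symmetric] ennreal_of_nat_eq_real_of_nat
            ennreal_times_divide mult.commute)
      also have "ennreal K = 2 * of_nat DIM('a) * emeasure lebesgue (ball (0::'a) (2 * L))"
        using L by (simp add: K_def emeasure_ball ennreal_mult ennreal_of_nat_eq_real_of_nat mult.assoc)
      finally show ?thesis .
    qed
    ultimately show ?thesis using eq by (simp cong: measurable_cong)
  qed
  have part2: "(\<lambda>\<omega>. Linf_norm (\<lambda>x. ?S (?X \<omega>) f x - ?g x)) \<in> borel_measurable M \<and>
      (\<integral>\<^sup>+ \<omega>. Linf_norm (\<lambda>x. ?S (?X \<omega>) f x - ?g x) \<partial>M)
            \<le> ennreal (10 * c * L powr \<alpha> * real n powr (- (\<alpha> / (real DIM('a) + \<alpha>))))"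
    if c: "0 < c" and \<alpha>: "0 < \<alpha>" "\<alpha> \<le> 1"
      and hol: "\<And>\<delta>. 0 < \<delta> \<Longrightarrow> modulus_of_continuity f \<delta> \<le> ennreal (c * \<delta> powr \<alpha>)" for c \<alpha>
  proof -
    have mod: "\<bar>f x - f y\<bar> \<le> c * dist x y powr \<alpha>" for x y
    proof (cases "x = y")
      case False
      have "ennreal \<bar>f x - f y\<bar> \<le> modulus_of_continuity f (dist x y)"
        unfolding modulus_of_continuity_def by (rule SUP_upper2[of "(x, y)"]) auto
      also have "\<dots> \<le> ennreal (c * dist x y powr \<alpha>)" using False by (intro hol) simp
      finally show ?thesis using c by (subst (asm) ennreal_le_iff) auto
    qed simp
    have mono: "c * a powr \<alpha> \<le> c * b powr \<alpha>" if "0 \<le> a" "a \<le> b" for a b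
      using that c \<alpha> by (intro mult_left_mono powr_mono2) auto
    \<comment> \<open>The supremum estimate uses the modulus at every pair of points, so it works
      with \<open>f\<close> itself, which is Borel by continuity.\<close>
    have fb: "f \<in> borel_measurable borel" by (rule holder_borel_measurable[OF \<alpha>(1) mod])
    \<comment> \<open>The Hoelder condition and the support bound \<open>f\<close>, so that the
      final estimate involves \<open>c\<close>, \<open>L\<close> and \<open>\<alpha>\<close> but not
      the norm of \<open>f\<close>.\<close>
    define m where "m = c * (2 * L) powr \<alpha>"
    have fm: "f x \<le> m" for x unfolding m_def by (rule holder_bound[OF L \<alpha>(1) c mod supp])
    have m0: "0 \<le> m" using c by (simp add: m_def)
    have gmod: "AE x in lborel. AE y in lborel. \<bar>?g x - ?g y\<bar> \<le> c * dist x y powr \<alpha>"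
      by (rule AE_modulus_symm_decr_rearrangement[OF L fb f_nonneg fm supp g, where \<phi>="\<lambda>t. c * t powr \<alpha>"])
         (auto intro: mono mod)
    define \<delta> where "\<delta> = 4 * L * real n powr (- (1 / (real DIM('a) + \<alpha>)))"
    have \<delta>: "0 < \<delta>" using L n by (simp add: \<delta>_def)
    define v where "v = unit_ball_vol (real DIM('a)) * \<delta> ^ DIM('a)"
    have v: "0 < v" using \<delta> by (simp add: v_def)
    let ?F = "\<lambda>x. \<integral>\<^sup>+y. ennreal \<bar>?S x f y - ?g y\<bar> \<partial>lborel"
    have meas: "(\<lambda>\<omega>. Linf_norm (\<lambda>x. ?S (?X \<omega>) f x - ?g x)) \<in> borel_measurable M"
      unfolding Linf_norm_def
    proof (rule borel_measurable_esssup_lebesgue)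
      have [measurable]: "(\<lambda>p. ?S (?X (fst p)) f (snd p)) \<in> borel_measurable (M \<Otimes>\<^sub>M lborel)"
        using measurable_compose[OF measurable_fst X]
        by (intro measurable_polarizations_PiM[OF fb]) auto
      show "(\<lambda>p. ennreal \<bar>?S (?X (fst p)) f (snd p) - ?g (snd p)\<bar>) \<in> borel_measurable (M \<Otimes>\<^sub>M lborel)"
        by measurable
    qed
    have "(\<integral>\<^sup>+ \<omega>. Linf_norm (\<lambda>x. ?S (?X \<omega>) f x - ?g x) \<partial>M) \<le>
        (\<integral>\<^sup>+ \<omega>. ennreal (2 * (c * \<delta> powr \<alpha>)) + ennreal (1 / v) * ?F (?X \<omega>) \<partial>M)"
    proof (rule nn_integral_mono)
      fix \<omega> assume "\<omega> \<in> space M"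
      note ad = adX[OF this]
      have Smod: "\<bar>?S (?X \<omega>) f x - ?S (?X \<omega>) f y\<bar> \<le> c * dist x y powr \<alpha>" for x y
        by (rule polarizations_modulus[where f=f and \<phi>="\<lambda>t. c * t powr \<alpha>", OF ad mono mod])
      show "Linf_norm (\<lambda>x. ?S (?X \<omega>) f x - ?g x) \<le> ennreal (2 * (c * \<delta> powr \<alpha>)) + ennreal (1 / v) * ?F (?X \<omega>)"
        unfolding v_def
        by (rule Linf_norm_diff_le[where \<phi>="\<lambda>t. c * t powr \<alpha>",
              OF borel_measurable_polarizations[OF fb] gm mono Smod gmod \<delta>])
    qed
    also have "\<dots> = ennreal (2 * (c * \<delta> powr \<alpha>)) + ennreal (1 / v) * (\<integral>\<^sup>+ \<omega>. ?F (?X \<omega>) \<partial>M)"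
    proof -
      have "(\<integral>\<^sup>+\<omega>. a + b * G \<omega> \<partial>M) = a + b * (\<integral>\<^sup>+\<omega>. G \<omega> \<partial>M)"
        if [measurable]: "G \<in> borel_measurable M" for a b :: ennreal and G
        by (simp add: nn_integral_add nn_integral_cmult M.emeasure_space_1)
      then show ?thesis using measurable_compose[OF X L1m[OF fb]] .
    qed
    also have "\<dots> \<le> ennreal (2 * (c * \<delta> powr \<alpha>)) + ennreal (1 / v) * ennreal (K / real n * m)"
    proof (intro add_left_mono mult_left_mono)
      have "(\<integral>\<^sup>+ \<omega>. ?F (?X \<omega>) \<partial>M) = (\<integral>\<^sup>+x. ?F x \<partial>?P)"
        by (rule nn_integral_indep_uniform_reflections[OF M indep unif n L1m[OF fb]])
      also have "\<dots> \<le> ennreal (K / real n) * ennreal m"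
        unfolding K_def by (rule expected_L1_distance_le[OF L fb f_nonneg fm supp g n])
      also have "\<dots> = ennreal (K / real n * m)"
        using K m0 by (intro ennreal_mult[symmetric]) auto
      finally show "(\<integral>\<^sup>+ \<omega>. ?F (?X \<omega>) \<partial>M) \<le> ennreal (K / real n * m)" .
    qed simp
    also have "\<dots> = ennreal (2 * (c * \<delta> powr \<alpha>) + 1 / v * (K / real n * m))"
      using v K m0 c by (subst ennreal_mult[symmetric]) (auto intro!: ennreal_plus[symmetric])
    also have "\<dots> \<le> ennreal (10 * c * L powr \<alpha> * real n powr (- (\<alpha> / (real DIM('a) + \<alpha>))))"
      unfolding v_def K_def m_def \<delta>_def
      by (intro ennreal_leI holder_rate[OF L c \<alpha> n]) simp
    finally show ?thesis using meas by (intro conjI)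
  qed
  show ?thesis unfolding WX using part1 part2 by blast
qed

end
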